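(* Let $\mathcal{S}=(S,+,\cdot)$ be a finite additively idempotent semiring whose multiplicative reduct $(S,\cdot)$ is a block-group all of whose subgroups are solvable. If all identities of $\mathcal{S}$ hold in the additively idempotent semiring $\mathcal{B}_2^1$, then the identities of $\mathcal{S}$ admit no finite basis.
   Context: An additively idempotent semiring is an algebra $(S,+,\cdot)$ of type $(2,2)$ such that $+$ and $\cdot$ are associative, $+$ is commutative and idempotent ($x+x=x$), and $x(y+z)=xy+xz$, $(y+z)x=yx+zx$ hold. Its multiplicative reduct is the semigroup $(S,\cdot)$. Identities of an additively idempotent semiring are identities of type $(2,2)$. A block-group is a semigroup satisfying, for all elements $e,f$, the two implications: if $ef=e^2=e$ and $fe=f^2=f$, then $e=f$; and if $ef=f^2=f$ and $fe=e^2=e$, then $e=f$. A subgroup of a semigroup is a subsemigroup that is a group (its identity element need not be an identity element of the whole semigroup). $\mathcal{B}_2^1=(B_2^1,+,\cdot)$ is the additively idempotent semiring whose carrier consists of the six zero-one $2\times2$ matrices $$\begin{pmatrix}0&0\\0&0\end{pmatrix},\ \begin{pmatrix}1&0\\0&1\end{pmatrix},\ \begin{pmatrix}0&1\\0&0\end{pmatrix},\ \begin{pmatrix}0&0\\1&0\end{pmatrix},\ \begin{pmatrix}1&0\\0&0\end{pmatrix},\ \begin{pmatrix}0&0\\0&1\end{pmatrix},$$ where $\cdot$ is the usual matrix multiplication and $+$ is the entry-wise (Hadamard) product: $(a_{ij})+(b_{ij}):=(a_{ij}b_{ij})$. A basis for the identities of an algebra $\mathcal{A}$ is a set $\Sigma$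 of identities holding in $\mathcal{A}$ (in the signature of $\mathcal{A}$) such that every algebra of the same type satisfying $\Sigma$ satisfies all identities of $\mathcal{A}$. The identities of $\mathcal{A}$ admit a finite basis if there is a finite such $\Sigma$. *)

theory Defs
  imports "HOL-Analysis.Cartesian_Space" "HOL-Algebra.Solvable_Groups"
begin

text \<open>
  Algebras of type (2,2). The record extends the library's \<^type>\<open>partial_object\<close>, so the
  universe of an algebra \<open>A\<close> is \<open>carrier A\<close>. The ring and semiring structures of HOL-Algebra are
  not used because they carry constants \<open>0\<close> and \<open>1\<close>, which are not part of this signature.
\<close>

record 'a alg22 = "'a partial_object" +
  add_op :: "'a \<Rightarrow> 'a \<Rightarrow> 'a"
  mul_op :: "'a \<Rightarrow> 'a \<Rightarrow> 'a"

definition is_alg22 :: "'a alg22 \<Rightarrow> bool" where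
  "is_alg22 A \<longleftrightarrow> carrier A \<noteq> {} \<and>
    (\<forall>x\<in>carrier A. \<forall>y\<in>carrier A. add_op A x y \<in> carrier A \<and> mul_op A x y \<in> carrier A)"

definition ai_semiring :: "'a alg22 \<Rightarrow> bool" where
  "ai_semiring A \<longleftrightarrow> is_alg22 A \<and>
    (\<forall>x\<in>carrier A. \<forall>y\<in>carrier A. \<forall>z\<in>carrier A.
       add_op A (add_op A x y) z = add_op A x (add_op A y z) \<and>
       mul_op A (mul_op A x y) z = mul_op A x (mul_op A y z) \<and>
       add_op A x y = add_op A y x \<and>
       add_op A x x = x \<and>
       mul_op A x (add_op A y z) = add_op A (mul_op A x y) (mul_op A x z) \<and>
       mul_op A (add_op A y z) x = add_op A (mul_op A y x) (mul_op A z x))"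

definition semigroup_on :: "'a set \<Rightarrow> ('a \<Rightarrow> 'a \<Rightarrow> 'a) \<Rightarrow> bool" where
  "semigroup_on S m \<longleftrightarrow> S \<noteq> {} \<and>
    (\<forall>x\<in>S. \<forall>y\<in>S. m x y \<in> S) \<and>
    (\<forall>x\<in>S. \<forall>y\<in>S. \<forall>z\<in>S. m (m x y) z = m x (m y z))"

definition block_group :: "'a set \<Rightarrow> ('a \<Rightarrow> 'a \<Rightarrow> 'a) \<Rightarrow> bool" where
  "block_group S m \<longleftrightarrow> semigroup_on S m \<and>
    (\<forall>e\<in>S. \<forall>f\<in>S.
       (m e f = m e e \<and> m e e = e \<and> m f e = m f f \<and> m f f = f \<longrightarrow> e = f) \<and>
       (m e f = m f f \<and> m f f = f \<and> m f e = m e e \<and> m e e = e \<longrightarrow> e = f))"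

text \<open>
  A subgroup of a semigroup is a subset \<open>H\<close> that is a group under the restricted multiplication,
  with some identity element \<open>e \<in> H\<close> that need not be an identity of the whole semigroup.
\<close>

definition subgroups_solvable :: "'a set \<Rightarrow> ('a \<Rightarrow> 'a \<Rightarrow> 'a) \<Rightarrow> bool" where
  "subgroups_solvable S m \<longleftrightarrow>
    (\<forall>H e. H \<subseteq> S \<and> group \<lparr>carrier = H, mult = m, one = e\<rparr>
       \<longrightarrow> solvable \<lparr>carrier = H, mult = m, one = e\<rparr>)"

datatype trm = Var nat | Add trm trm | Mul trm trm

primrec eval_trm :: "'a alg22 \<Rightarrow> (nat \<Rightarrow> 'a) \<Rightarrow> trm \<Rightarrow> 'a" where
  "eval_trm A v (Var n) = v n"
| "eval_trm A v (Add s t) = add_op A (eval_trm A v s) (eval_trm A v t)"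
| "eval_trm A v (Mul s t) = mul_op A (eval_trm A v s) (eval_trm A v t)"

type_synonym identity = "trm \<times> trm"

definition holds_in :: "identity \<Rightarrow> 'a alg22 \<Rightarrow> bool" where
  "holds_in \<epsilon> A \<longleftrightarrow>
    (\<forall>v. range v \<subseteq> carrier A \<longrightarrow> eval_trm A v (fst \<epsilon>) = eval_trm A v (snd \<epsilon>))"

definition identities_of :: "'a alg22 \<Rightarrow> identity set" where
  "identities_of A = {\<epsilon>. holds_in \<epsilon> A}"

text \<open>
  HOL cannot quantify over all types inside a formula, so ``every algebra of the same type'' ranges
  over the algebras \<open>B\<close> whose carrier is a set of elements of the type \<open>'b\<close> given as a parameter.
  Restricting the universe makes it easier to be a basis. Hence, for any one type \<open>'b\<close>, the
  nonexistence of a finite basis relative to \<open>'b\<close> entails its nonexistence relative to all algebras.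
  If \<open>'b\<close> is infinite nothing is lost either: an identity failing in an algebra already fails in a
  finitely generated, hence countable, subalgebra, and this has an isomorphic copy inside \<open>'b\<close>.
\<close>

definition identity_basis :: "'b itself \<Rightarrow> 'a alg22 \<Rightarrow> identity set \<Rightarrow> bool" where
  "identity_basis _ A E \<longleftrightarrow>
    E \<subseteq> identities_of A \<and>
    (\<forall>B :: 'b alg22. is_alg22 B \<and> E \<subseteq> identities_of B \<longrightarrow> identities_of A \<subseteq> identities_of B)"

definition has_finite_basis :: "'b itself \<Rightarrow> 'a alg22 \<Rightarrow> bool" where
  "has_finite_basis T A \<longleftrightarrow> (\<exists>E. finite E \<and> identity_basis T A E)"

definition mat22 :: "int \<Rightarrow> int \<Rightarrow> int \<Rightarrow> int \<Rightarrow> int ^ 2 ^ 2" where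
  "mat22 a b c d = vector [vector [a, b], vector [c, d]]"

definition hadamard :: "int ^ 2 ^ 2 \<Rightarrow> int ^ 2 ^ 2 \<Rightarrow> int ^ 2 ^ 2" where
  "hadamard A B = (\<chi> i j. A $ i $ j * B $ i $ j)"

definition B21 :: "(int ^ 2 ^ 2) alg22" where
  "B21 = \<lparr>carrier =
            {mat22 0 0 0 0, mat22 1 0 0 1, mat22 0 1 0 0,
             mat22 0 0 1 0, mat22 1 0 0 0, mat22 0 0 0 1},
          add_op = hadamard,
          mul_op = (**)\<rparr>"

lemma mat22_mult:
  "mat22 a b c d ** mat22 a' b' c' d' =
     mat22 (a * a' + b * c') (a * b' + b * d') (c * a' + d * c') (c * b' + d * d')"
  by (simp add: mat22_def matrix_matrix_mult_def vec_eq_iff forall_2 sum_2)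

lemma hadamard_mat22:
  "hadamard (mat22 a b c d) (mat22 a' b' c' d') = mat22 (a * a') (b * b') (c * c') (d * d')"
  by (simp add: mat22_def hadamard_def vec_eq_iff forall_2)

lemma ai_semiring_B21: "ai_semiring B21"
  by (simp add: ai_semiring_def is_alg22_def B21_def mat22_mult hadamard_mat22)

end

theory Submission
  imports Defs "HOL-Library.Nat_Bijection"
begin

text \<open>
  The words \<open>w\<^sub>h\<close> are defined by \<open>w\<^sub>0 = x\<close> and
  \<open>w\<^sub>h\<^sub>+\<^sub>1 = w\<^sub>h\<^sub>,\<^sub>1 \<dots> w\<^sub>h\<^sub>,\<^sub>n w\<^sub>h\<^sub>,\<^sub>1\<inverse> \<dots> w\<^sub>h\<^sub>,\<^sub>n\<inverse>\<close>, where the \<open>w\<^sub>h\<^sub>,\<^sub>l\<close> are copies of \<open>w\<^sub>h\<close> over disjoint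
  alphabets and inverses are imitated by powers. In a finite block-group with solvable subgroups the
  value of \<open>w\<^sub>h\<close> is idempotent for some \<open>h\<close> that does not depend on \<open>n\<close>: a non-idempotent value either
  generates a strictly smaller ideal than one of its factors at a lower level, or lies, along with its
  factors, in one maximal subgroup, where each level is one step of the derived series.

  On the other hand, let the letters act as partial injections on the path spelled by \<open>w\<^sub>h\<close>. They
  generate, under composition and intersection, an algebra in which \<open>w\<^sub>h\<close> leads from the first point of
  the path to the last one, so that \<open>w\<^sub>h\<close> and its square differ. Fewer than \<open>n\<close> elements of this algebra
  always miss some block at every level. For such elements there are enough two-valued functions on
  the path that map them into \<open>B\<^sub>2\<^sup>1\<close>, and hence every identity of \<open>B\<^sub>2\<^sup>1\<close> in fewer than \<open>n\<close>
  variables holds in this algebra.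
\<close>

section \<open>Partial injections on iterated paths\<close>

text \<open>The identity that equates the word of the level chosen for \<open>S\<close> with its
  square also holds in \<open>B21\<close>, by the assumption on \<open>S\<close>. Hence no
  two-valued function that is compatible with the letters themselves can separate the two ends of
  the path, and separation has to exploit a block that no given relation uses. A function whose
  value changes inside such a free block does separate the ends; functions pulled back along the
  retractions onto single blocks never do, because both ends retract to the same point. The
  commutator-like shape of the word serves both sides. In a group it forces a step down the derived
  series. On the path it makes every block occur twice, in opposite directions, so that a function
  pulled back from one block takes two possibly different constants on the two copies of any other
  block; such changes cancel in pairs. Intersections do no harm because relations on different
  blocks have at most one pair in common.\<close>

text \<open>
  The points \<open>0, \<dots>, path_len n h\<close> are the vertices of the path spelled by the word of level \<open>h\<close>.
  A path of level \<open>h + 1\<close> is made of \<open>2 n\<close> copies of a path of length \<open>L\<close>; for \<open>l < n\<close> the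
  copies number \<open>l\<close> and \<open>n + l\<close> form block \<open>l\<close>, and copy \<open>n + l\<close> is traversed backwards.
\<close>

definition copy_pt :: "nat \<Rightarrow> nat \<Rightarrow> nat \<Rightarrow> nat \<Rightarrow> nat" where
  "copy_pt n L c t = (if c < n then c * L + t else (c + 1) * L - t)"

text \<open>
  The retraction of the long path onto block \<open>m\<close>, which collapses every other block to the end points.
  All subtractions are truncated on purpose.
\<close>

definition fold_pt :: "nat \<Rightarrow> nat \<Rightarrow> nat \<Rightarrow> nat \<Rightarrow> nat" where
  "fold_pt n L m p = min L (p - m * L) - min L (p - (n + m) * L)"

definition double :: "nat \<Rightarrow> nat \<Rightarrow> nat \<Rightarrow> (nat \<times> nat) set \<Rightarrow> (nat \<times> nat) set" where
  "double n L l y = map_prod (copy_pt n L l) (copy_pt n L l) ` y \<union> map_prod (copy_pt n L (n + l)) (copy_pt n L (n + l)) ` y"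

definition rank1 :: "nat \<Rightarrow> (nat \<times> nat) set \<Rightarrow> bool" where
  "rank1 N y \<longleftrightarrow> y \<subseteq> {..N} \<times> {..N} \<and> (\<forall>z\<in>y. \<forall>z'\<in>y. z = z')"

primrec path_len :: "nat \<Rightarrow> nat \<Rightarrow> nat" where
  "path_len n 0 = 1"
| "path_len n (Suc h) = 2 * n * path_len n h"

primrec path_rels :: "nat \<Rightarrow> nat \<Rightarrow> (nat \<times> nat) set set" where
  "path_rels n 0 = {y. rank1 1 y}"
| "path_rels n (Suc h) =
     {y. rank1 (path_len n (Suc h)) y} \<union> (\<Union>l<n. double n (path_len n h) l ` path_rels n h)"

text \<open>
  \<open>compatible \<phi> y\<close> says that the \<open>\<phi>\<close>-image of \<open>y\<close> is one of the six partial injections of a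
  two-element set that make up the semiring \<open>B21\<close>.
\<close>

definition compatible :: "(nat \<Rightarrow> bool) \<Rightarrow> (nat \<times> nat) set \<Rightarrow> bool" where
  "compatible \<phi> y \<longleftrightarrow> (\<forall>(a, b)\<in>y. \<phi> a = \<phi> b) \<or> (\<exists>c. \<forall>(a, b)\<in>y. \<phi> a = c \<and> \<phi> b = (\<not> c))"

section \<open>Arithmetic of the copies and of the retractions onto blocks\<close>

lemma less_mult_step: "a < b \<Longrightarrow> a * L + L \<le> b * (L :: nat)"
  using mult_le_mono1[of "Suc a" b L] by simp

lemma copy_pt_less: "l < n \<Longrightarrow> copy_pt n L l t = l * L + t"
  by (simp add: copy_pt_def)

lemma copy_pt_ge: "copy_pt n L (n + l) t = n * L + l * L + L - t"
  by (simp add: copy_pt_def algebra_simps)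

lemma fold_pt_alt: "fold_pt n L m p = min L (p - m * L) - min L (p - (n * L + m * L))"
  by (simp add: fold_pt_def algebra_simps)

lemma copy_pt_le:
  assumes "l < n" "t \<le> L"
  shows "copy_pt n L l t \<le> n * L" "n * L \<le> copy_pt n L (n + l) t" "copy_pt n L (n + l) t \<le> 2 * n * L"
  using assms less_mult_step[of l n L] by (auto simp: copy_pt_less copy_pt_ge)

lemma fold_pt_copy_pt:
  assumes "l < n" "t \<le> L"
  shows "fold_pt n L l (copy_pt n L l t) = t" "fold_pt n L l (copy_pt n L (n + l) t) = t"
  using assms less_mult_step[of l n L] by (auto simp: copy_pt_less copy_pt_ge fold_pt_alt)

text \<open>The retraction climbs from 0 to \<open>L\<close> along copy \<open>b\<close>, stays at
  \<open>L\<close>, and falls back to 0 along copy \<open>n + b\<close>. So the two copies of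
  another block are sent to opposite ends.\<close>

lemma fold_pt_copy_pt_other:
  assumes "l < n" "b < n" "b \<noteq> l" "t \<le> L"
  shows "fold_pt n L b (copy_pt n L l t) = (if b < l then L else 0)"
    "fold_pt n L b (copy_pt n L (n + l) t) = (if l < b then L else 0)"
  using assms less_mult_step[of l n L] less_mult_step[of b n L] less_mult_step[of b l L] less_mult_step[of l b L]
  by (auto simp: copy_pt_less copy_pt_ge fold_pt_alt)

lemma fold_pt_le: "fold_pt n L m p \<le> L"
  by (simp add: fold_pt_def)

lemma copy_pt_surj:
  assumes "p \<le> 2 * n * L" "L > 0" "n > 0"
  shows "\<exists>l<n. \<exists>t\<le>L. p = copy_pt n L l t \<or> p = copy_pt n L (n + l) t"
proof -
  consider "p < n * L" | "n * L \<le> p" "p < 2 * n * L" | "p = 2 * n * L" using assms by linarith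
  then show ?thesis
  proof cases
    case 1
    then have "p div L < n" using assms by (simp add: less_mult_imp_div_less)
    then have "p = copy_pt n L (p div L) (p mod L)" by (simp add: copy_pt_less)
    then show ?thesis using \<open>p div L < n\<close> assms(2) by (metis less_imp_le mod_less_divisor)
  next
    case 2
    define q where "q = p - n * L"
    have "q < n * L" using 2 by (simp add: q_def)
    then have ql: "q div L < n" using assms by (simp add: less_mult_imp_div_less)
    have "q = q div L * L + q mod L" by simp
    moreover have "q mod L < L" using assms by simp
    ultimately have "p = copy_pt n L (n + q div L) (L - q mod L)"
      using 2 by (simp add: copy_pt_ge q_def)
    then show ?thesis using ql by (metis diff_le_self)
  next
    case 3
    have "(n - 1) * L + L = n * L" using assms by (cases n) auto
    then have "p = copy_pt n L (n + (n - 1)) 0" using 3 by (simp add: copy_pt_ge)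
    then show ?thesis using assms by (metis diff_less zero_le zero_less_one)
  qed
qed

lemma fold_pt_0: "fold_pt n L m 0 = 0"
  by (simp add: fold_pt_def)

lemma fold_pt_last: "m < n \<Longrightarrow> fold_pt n L m (2 * n * L) = 0"
proof -
  assume "m < n"
  then have "m * L + L \<le> n * L" by (rule less_mult_step)
  then have "L \<le> n * L + n * L - m * L" "L \<le> n * L + n * L - (n * L + m * L)" by linarith+
  moreover have "2 * n * L = n * L + n * L" by simp
  ultimately show ?thesis unfolding fold_pt_alt by (metis min.absorb1 diff_self_eq_0)
qed

lemma fold_pt_inj_first:
  assumes "r < q" "q \<le> n * L" "L > 0"
  shows "\<exists>m<n. fold_pt n L m r \<noteq> fold_pt n L m q"
proof -
  define m where "m = r div L"
  have "m < n" using assms by (simp add: m_def less_mult_imp_div_less)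
  obtain u where "r = m * L + u" "u < L"
    using assms by (metis div_mod_decomp m_def mod_less_divisor)
  then have "fold_pt n L m r \<noteq> fold_pt n L m q"
    using assms by (auto simp: fold_pt_alt min_def)
  then show ?thesis using \<open>m < n\<close> by blast
qed

lemma fold_pt_inj_second:
  assumes "r < q" "n * L \<le> r" "q \<le> 2 * n * L" "L > 0"
  shows "\<exists>m<n. fold_pt n L m r \<noteq> fold_pt n L m q"
proof -
  define s where "s = r - n * L"
  define m where "m = s div L"
  have "s < n * L" using assms by (simp add: s_def)
  then have "m < n" using assms by (simp add: m_def less_mult_imp_div_less)
  obtain u where "s = m * L + u" "u < L"
    using assms by (metis div_mod_decomp m_def mod_less_divisor)
  then have "r = n * L + m * L + u" "u < L" using assms by (auto simp: s_def)
  then have "fold_pt n L m r \<noteq> fold_pt n L m q"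
    using assms less_mult_step[OF \<open>m < n\<close>, of L] by (auto simp: fold_pt_alt min_def)
  then show ?thesis using \<open>m < n\<close> by blast
qed

text \<open>Two points of the same half are told apart by a block with a copy in that half that
  contains the left one. Otherwise \<open>r\<close> and \<open>q\<close> lie strictly on different
  sides of the middle. Then block 0 forces \<open>r < L\<close>, after which block
  \<open>n - 1\<close> forces \<open>q\<close> to be the last point, and block 0 again gives
  \<open>r = 0\<close>.\<close>

lemma fold_pt_inj:
  assumes "r < q" "q \<le> 2 * n * L" "L > 0" "n \<ge> 2" and eq: "\<And>m. m < n \<Longrightarrow> fold_pt n L m r = fold_pt n L m q"
  shows "r = 0 \<and> q = 2 * n * L"
proof -
  have rq: "r < n * L" "n * L < q"
    using fold_pt_inj_first[of r q n L] fold_pt_inj_second[of r q n L] assms by (force simp: not_less)+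
  have n: "(n - 1) * L + L = n * L" "n - 1 < n" "0 < n" using assms by (cases n; auto)+
  have n2: "L + L \<le> n * L" using less_mult_step[of 1 n L] assms by simp
  have 1: "min L r = L - min L (q - n * L)"
    using eq[OF n(3)] rq n2 by (simp add: fold_pt_alt)
  have 2: "r - (n - 1) * L = L - min L (q - (n * L + (n - 1) * L))"
    using eq[OF n(2)] rq n by (auto simp: fold_pt_alt)
  have "r = 0" using 1 2 n n2 rq by (auto simp: min_def split: if_splits)
  moreover have "q = 2 * n * L" using 2 \<open>r = 0\<close> n rq assms by (auto simp: min_def split: if_splits)
  ultimately show ?thesis by simp
qed

section \<open>Doubled relations as partial injections of the path\<close>

lemma doubleD:
  assumes "(p, q) \<in> double n L l y"
  shows "\<exists>c\<in>{l, n + l}. \<exists>(a, b)\<in>y. p = copy_pt n L c a \<and> q = copy_pt n L c b"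
  using assms by (force simp: double_def)

lemma doubleI: "(a, b) \<in> y \<Longrightarrow> c = l \<or> c = n + l \<Longrightarrow> (copy_pt n L c a, copy_pt n L c b) \<in> double n L l y"
  by (force simp: double_def)

lemma Domain_double: "Domain (double n L l y) = copy_pt n L l ` Domain y \<union> copy_pt n L (n + l) ` Domain y"
  by (force simp: double_def)

lemma path_len_pos: "n > 0 \<Longrightarrow> path_len n h > 0"
  by (induction h) auto

lemma converse_double: "(double n L l y)\<inverse> = double n L l (y\<inverse>)"
  by (force simp: double_def)

lemma rank1_converse: "rank1 N (y\<inverse>) \<longleftrightarrow> rank1 N y"
  by (force simp: rank1_def)

lemma path_rels_SucE:
  assumes "y \<in> path_rels n (Suc h)"
  obtains (rank1) "rank1 (path_len n (Suc h)) y"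
  | (double) l f where "\<not> rank1 (path_len n (Suc h)) y" "l < n" "f \<in> path_rels n h" "y = double n (path_len n h) l f"
  using assms by (cases "rank1 (path_len n (Suc h)) y") (auto simp del: path_len.simps)

lemma path_rels_converse: "y \<in> path_rels n h \<Longrightarrow> y\<inverse> \<in> path_rels n h"
proof (induction h arbitrary: y)
  case 0
  then show ?case by (simp add: rank1_converse)
next
  case (Suc h)
  then show ?case
    by (cases "rank1 (path_len n (Suc h)) y") (fastforce simp: rank1_converse converse_double simp del: path_len.simps)+
qed

lemma path_rels_bounded: "y \<in> path_rels n h \<Longrightarrow> y \<subseteq> {..path_len n h} \<times> {..path_len n h}"
proof (induction h arbitrary: y)
  case 0
  then show ?case by (auto simp: rank1_def)
next
  case (Suc h)
  show ?case
  proof (cases "rank1 (path_len n (Suc h)) y")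
    case True
    then show ?thesis by (auto simp: rank1_def)
  next
    case False
    then obtain l f where lf: "l < n" "f \<in> path_rels n h" "y = double n (path_len n h) l f"
      using Suc.prems by auto
    then have "f \<subseteq> {..path_len n h} \<times> {..path_len n h}" using Suc.IH by blast
    then have "copy_pt n (path_len n h) c a \<le> path_len n (Suc h) \<and> copy_pt n (path_len n h) c b \<le> path_len n (Suc h)"
      if "(a, b) \<in> f" "c \<in> {l, n + l}" for a b c
      using that copy_pt_le[OF lf(1), of a "path_len n h"] copy_pt_le[OF lf(1), of b "path_len n h"]
      by auto
    moreover have "\<exists>c\<in>{l, n + l}. \<exists>(a, b)\<in>f. p = copy_pt n (path_len n h) c a \<and> q = copy_pt n (path_len n h) c b"
      if "(p, q) \<in> y" for p q
      using doubleD that lf(3) by blast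
    ultimately show ?thesis by (fastforce simp del: path_len.simps)
  qed
qed

text \<open>The start of the path belongs to block 0 only and its end to block \<open>n - 1\<close>
  only, while a doubled relation lives on a single block. The fact limits how relations on different
  blocks can interact, since blocks meet only in end points of copies.\<close>

lemma path_rels_no_both_ends:
  assumes "y \<in> path_rels n h" "n \<ge> 2"
  shows "\<not> (0 \<in> Domain y \<and> path_len n h \<in> Domain y)"
proof (cases h)
  case 0
  then show ?thesis using assms by (fastforce simp: rank1_def)
next
  case (Suc g)
  have L: "path_len n g > 0" using assms path_len_pos by simp
  show ?thesis
  proof (cases "rank1 (path_len n h) y")
    case True
    then show ?thesis using path_len_pos[of n h] assms by (fastforce simp: rank1_def)
  next
    case False
    then obtain l f where lf: "l < n" "f \<in> path_rels n g" "y = double n (path_len n g) l f"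
      using assms Suc by auto
    have f: "a \<le> path_len n g" if "a \<in> Domain f" for a using path_rels_bounded[OF lf(2)] that by blast
    have n2: "path_len n g + path_len n g \<le> n * path_len n g"
      using less_mult_step[of 1 n "path_len n g"] assms by simp
    have "l = 0" if y0: "0 \<in> Domain y"
    proof -
      obtain a where a: "a \<in> Domain f" "0 = copy_pt n (path_len n g) l a \<or> 0 = copy_pt n (path_len n g) (n + l) a"
        using y0 unfolding lf(3) Domain_double by blast
      then show ?thesis using f[OF a(1)] lf(1) L n2 unfolding copy_pt_ge by (auto simp: copy_pt_less)
    qed
    moreover have "l = n - 1" if y0: "path_len n h \<in> Domain y"
    proof (rule ccontr)
      assume "l \<noteq> n - 1"
      then have "Suc l < n" using lf by simp
      then have l: "l * path_len n g + path_len n g + path_len n g \<le> n * path_len n g"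
        using less_mult_step[of "Suc l" n "path_len n g"] by simp
      have h: "path_len n h = n * path_len n g + n * path_len n g" using Suc by simp
      obtain a where a: "a \<in> Domain f" "path_len n h = copy_pt n (path_len n g) l a \<or> path_len n h = copy_pt n (path_len n g) (n + l) a"
        using y0 unfolding lf(3) Domain_double by blast
      then show False using f[OF a(1)] lf(1) L l h unfolding copy_pt_ge by (auto simp: copy_pt_less)
    qed
    ultimately show ?thesis using assms(2) by fastforce
  qed
qed

section \<open>Closure under intersection and composition\<close>

lemma copy_pt_inj:
  assumes "l < n" "n \<ge> 2" "L > 0" "a \<le> L" "b \<le> L" "c \<in> {l, n + l}" "d \<in> {l, n + l}" "copy_pt n L c a = copy_pt n L d b"
  shows "c = d \<and> a = b"
proof -
  have "a = b" using assms fold_pt_copy_pt[of l n] by (metis empty_iff insert_iff)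
  moreover have "copy_pt n L l a < copy_pt n L (n + l) b" if "a \<le> L" "b \<le> L" for a b
    using that assms less_mult_step[of 1 n L] by (simp add: copy_pt_less copy_pt_ge)
  ultimately show ?thesis using assms by (metis empty_iff insert_iff less_irrefl)
qed

lemma copy_pt_common_end:
  assumes "l < n" "m < n" "l \<noteq> m" "a \<le> L" "b \<le> L" "c \<in> {l, n + l}" "d \<in> {m, n + m}" "copy_pt n L c a = copy_pt n L d b"
  shows "a \<in> {0, L}" "b \<in> {0, L}"
proof -
  have "fold_pt n L l (copy_pt n L c a) = a" "fold_pt n L m (copy_pt n L d b) = b"
    using assms fold_pt_copy_pt by blast+
  moreover have "fold_pt n L l (copy_pt n L d b) \<in> {0, L}" "fold_pt n L m (copy_pt n L c a) \<in> {0, L}"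
    using assms fold_pt_copy_pt_other[of m n l b L] fold_pt_copy_pt_other[of l n m a L] by auto
  ultimately show "a \<in> {0, L}" "b \<in> {0, L}" using assms(8) by auto
qed

text \<open>The positions of the two copies of a point of block \<open>l\<close> add up to
  \<open>(n + 2 * l + 1) * L\<close>, whatever the point is. If both copies of \<open>a\<close> met
  copies of \<open>b\<close>, the two sums would agree and force \<open>l = m\<close>.\<close>

lemma copy_pt_common_unique:
  assumes "l < n" "m < n" "l \<noteq> m" "n \<ge> 2" "L > 0" "a \<le> L" "b \<le> L"
    and "c \<in> {l, n + l}" "d \<in> {m, n + m}" "copy_pt n L c a = copy_pt n L d b"
    and "c' \<in> {l, n + l}" "d' \<in> {m, n + m}" "copy_pt n L c' a = copy_pt n L d' b"
  shows "c = c'"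
proof (rule ccontr)
  assume "c \<noteq> c'"
  then have "d \<noteq> d'" using copy_pt_inj[of l n L a a c c'] assms by metis
  have "copy_pt n L l a + copy_pt n L (n + l) a = copy_pt n L m b + copy_pt n L (n + m) b"
    using \<open>c \<noteq> c'\<close> \<open>d \<noteq> d'\<close> assms by auto
  then have "l * L + a + (n * L + l * L + L - a) = m * L + b + (n * L + m * L + L - b)"
    using assms(1,2) unfolding copy_pt_ge by (simp add: copy_pt_less)
  then have "l * L = m * L" using assms(6,7) by linarith
  then show False using assms(3,5) by simp
qed

lemma path_rels_single_valued:
  assumes "y \<in> path_rels n h" "n \<ge> 2" "(a, b) \<in> y" "(a, c) \<in> y"
  shows "b = c"
  using assms
proof (induction h arbitrary: y a b c)
  case 0
  then show ?case by (auto simp: rank1_def)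
next
  case (Suc h)
  show ?case
  proof (cases "rank1 (path_len n (Suc h)) y")
    case True
    then show ?thesis using Suc.prems by (auto simp: rank1_def)
  next
    case False
    then obtain l f where lf: "l < n" "f \<in> path_rels n h" "y = double n (path_len n h) l f"
      using path_rels_SucE[OF Suc.prems(1)] by metis
    obtain i a1 b1 where 1: "i \<in> {l, n + l}" "(a1, b1) \<in> f" "a = copy_pt n (path_len n h) i a1" "b = copy_pt n (path_len n h) i b1"
      using doubleD[OF Suc.prems(3)[unfolded lf(3)]] by blast
    obtain j a2 c2 where 2: "j \<in> {l, n + l}" "(a2, c2) \<in> f" "a = copy_pt n (path_len n h) j a2" "c = copy_pt n (path_len n h) j c2"
      using doubleD[OF Suc.prems(4)[unfolded lf(3)]] by blast
    have "a1 \<le> path_len n h" "a2 \<le> path_len n h" using path_rels_bounded[OF lf(2)] 1(2) 2(2) by auto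
    then have "i = j \<and> a1 = a2"
      using copy_pt_inj[OF lf(1) Suc.prems(2) _ _ _ 1(1) 2(1), of "path_len n h" a1 a2] 1(3) 2(3)
        path_len_pos[of n h] Suc.prems(2) by simp
    then show ?thesis using Suc.IH[OF lf(2) Suc.prems(2) 1(2)] 2(2) 1(4) 2(4) by metis
  qed
qed

lemma path_rels_single_valued_conv:
  assumes "y \<in> path_rels n h" "n \<ge> 2" "(b, a) \<in> y" "(c, a) \<in> y"
  shows "b = c"
  using path_rels_single_valued[OF path_rels_converse[OF assms(1)] assms(2)] assms by blast

lemma rank1_subset: "rank1 N y \<Longrightarrow> z \<subseteq> y \<Longrightarrow> rank1 N z"
  unfolding rank1_def by blast

lemma double_Int:
  assumes "l < n" "n \<ge> 2" "L > 0" "f \<subseteq> {..L} \<times> {..L}" "g \<subseteq> {..L} \<times> {..L}"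
  shows "double n L l f \<inter> double n L l g = double n L l (f \<inter> g)"
proof -
  have "(p, q) \<in> double n L l (f \<inter> g)" if f: "(p, q) \<in> double n L l f" and g: "(p, q) \<in> double n L l g" for p q
  proof -
    obtain c a b where 1: "c \<in> {l, n + l}" "(a, b) \<in> f" "p = copy_pt n L c a" "q = copy_pt n L c b" using doubleD[OF f] by blast
    obtain d a' b' where 2: "d \<in> {l, n + l}" "(a', b') \<in> g" "p = copy_pt n L d a'" "q = copy_pt n L d b'" using doubleD[OF g] by blast
    have "a \<le> L" "b \<le> L" "a' \<le> L" "b' \<le> L" using 1 2 assms by auto
    then have "c = d \<and> a = a'" "c = d \<and> b = b'"
      using copy_pt_inj[OF assms(1-3) _ _ 1(1) 2(1)] 1 2 by metis+
    then show ?thesis using 1 2 by (auto intro: doubleI)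
  qed
  moreover have "double n L l (f \<inter> g) \<subseteq> double n L l f \<inter> double n L l g" by (auto simp: double_def)
  ultimately show ?thesis by auto
qed

lemma double_relcomp:
  assumes "l < n" "n \<ge> 2" "L > 0" "f \<subseteq> {..L} \<times> {..L}" "g \<subseteq> {..L} \<times> {..L}"
  shows "double n L l f O double n L l g = double n L l (f O g)"
proof -
  have A: "(p, q) \<in> double n L l (f O g)" if f: "(p, x) \<in> double n L l f" and g: "(x, q) \<in> double n L l g" for p q x
  proof -
    obtain c a b where 1: "c \<in> {l, n + l}" "(a, b) \<in> f" "p = copy_pt n L c a" "x = copy_pt n L c b" using doubleD[OF f] by blast
    obtain d a' b' where 2: "d \<in> {l, n + l}" "(a', b') \<in> g" "x = copy_pt n L d a'" "q = copy_pt n L d b'" using doubleD[OF g] by blast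
    have "b \<le> L" "a' \<le> L" using 1 2 assms by auto
    then have "c = d \<and> b = a'"
      using copy_pt_inj[OF assms(1-3) _ _ 1(1) 2(1)] 1 2 by metis
    then show ?thesis using 1 2 by (auto intro!: doubleI)
  qed
  have B: "(p, q) \<in> double n L l f O double n L l g" if pq: "(p, q) \<in> double n L l (f O g)" for p q
  proof -
    obtain c a b where 1: "c \<in> {l, n + l}" "(a, b) \<in> f O g" "p = copy_pt n L c a" "q = copy_pt n L c b"
      using doubleD[OF pq] by blast
    then obtain x where x: "(a, x) \<in> f" "(x, b) \<in> g" by blast
    have c: "c = l \<or> c = n + l" using 1 by simp
    show ?thesis unfolding 1(3,4) by (rule relcompI[OF doubleI[OF x(1) c] doubleI[OF x(2) c]])
  qed
  show ?thesis by (intro equalityI subrelI B) (use A in blast)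
qed

text \<open>A common pair starts at a junction of the two blocks, so its local coordinates are end
  points of the short path. Neither domain contains both end points; hence the coordinates are
  determined, and with them the junction.\<close>

lemma rank1_Int_double:
  assumes "l < n" "m < n" "l \<noteq> m" "n \<ge> 2" "f \<in> path_rels n h" "g \<in> path_rels n h"
  shows "rank1 (path_len n (Suc h)) (double n (path_len n h) l f \<inter> double n (path_len n h) m g)"
proof -
  define L where "L = path_len n h"
  have L: "L > 0" using path_len_pos assms by (simp add: L_def)
  have bd: "a \<le> L \<and> b \<le> L" if "(a, b) \<in> f \<or> (a, b) \<in> g" for a b
    using that path_rels_bounded[OF assms(5)] path_rels_bounded[OF assms(6)] by (auto simp: L_def)
  have rep: thesis
    if pq: "(p, q) \<in> double n L l f \<inter> double n L m g"
      and th: "\<And>c a b d a' b'. c \<in> {l, n + l} \<Longrightarrow> d \<in> {m, n + m} \<Longrightarrow> (a, b) \<in> f \<Longrightarrow> (a', b') \<in> g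
      \<Longrightarrow> p = copy_pt n L c a \<Longrightarrow> q = copy_pt n L c b \<Longrightarrow> copy_pt n L c a = copy_pt n L d a' \<Longrightarrow> thesis"
    for p q thesis
  proof -
    obtain c a b where 1: "c \<in> {l, n + l}" "(a, b) \<in> f" "p = copy_pt n L c a" "q = copy_pt n L c b"
      using doubleD[of p q n L l f] pq by blast
    obtain d a' b' where 2: "d \<in> {m, n + m}" "(a', b') \<in> g" "p = copy_pt n L d a'" "q = copy_pt n L d b'"
      using doubleD[of p q n L m g] pq by blast
    show thesis using th[OF 1(1) 2(1) 1(2) 2(2) 1(3,4)] 1 2 by simp
  qed
  have U: "z = z'" if z: "z \<in> double n L l f \<inter> double n L m g" "z' \<in> double n L l f \<inter> double n L m g" for z z'
  proof -
    obtain p q p' q' where pq: "z = (p, q)" "z' = (p', q')" by fastforce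
    obtain c a b d a1 b1 where 1: "c \<in> {l, n + l}" "d \<in> {m, n + m}" "(a, b) \<in> f" "(a1, b1) \<in> g"
      "p = copy_pt n L c a" "q = copy_pt n L c b" "copy_pt n L c a = copy_pt n L d a1"
      by (rule rep[of p q]) (use z pq in auto)
    obtain c' a' b' d' a1' b1' where 2: "c' \<in> {l, n + l}" "d' \<in> {m, n + m}" "(a', b') \<in> f" "(a1', b1') \<in> g"
      "p' = copy_pt n L c' a'" "q' = copy_pt n L c' b'" "copy_pt n L c' a' = copy_pt n L d' a1'"
      by (rule rep[of p' q']) (use z pq in auto)
    have bds: "a \<le> L" "a1 \<le> L" "a' \<le> L" "a1' \<le> L" using bd 1(3,4) 2(3,4) by blast+
    have "a \<in> {0, L}" "a1 \<in> {0, L}" "a' \<in> {0, L}" "a1' \<in> {0, L}"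
      using copy_pt_common_end[OF assms(1-3) bds(1,2) 1(1,2,7)] copy_pt_common_end[OF assms(1-3) bds(3,4) 2(1,2,7)] by blast+
    then have aa: "a = a'" "a1 = a1'"
      using path_rels_no_both_ends[OF assms(5,4)] path_rels_no_both_ends[OF assms(6,4)] 1(3,4) 2(3,4)
      unfolding L_def by blast+
    then have "c = c'"
      using copy_pt_common_unique[OF assms(1-4) L bds(1,2) 1(1,2,7) 2(1,2)] 2(7) by simp
    moreover have "b = b'" using path_rels_single_valued[OF assms(5,4)] aa 1(3) 2(3) by blast
    ultimately show ?thesis using pq aa 1(5,6) 2(5,6) by simp
  qed
  have B: "double n L l f \<inter> double n L m g \<subseteq> {..path_len n (Suc h)} \<times> {..path_len n (Suc h)}"
  proof -
    have "double n L l f \<in> path_rels n (Suc h)" using assms by (auto simp: L_def)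
    then show ?thesis using path_rels_bounded by blast
  qed
  show ?thesis unfolding rank1_def L_def[symmetric]
    by (intro conjI ballI) (fact B, fact U)
qed

text \<open>Here the junction is the intermediate point. The range of \<open>f\<close> is controlled
  as the domain of its converse.\<close>

lemma rank1_relcomp_double:
  assumes "l < n" "m < n" "l \<noteq> m" "n \<ge> 2" "f \<in> path_rels n h" "g \<in> path_rels n h"
  shows "rank1 (path_len n (Suc h)) (double n (path_len n h) l f O double n (path_len n h) m g)"
proof -
  define L where "L = path_len n h"
  have L: "L > 0" using path_len_pos assms by (simp add: L_def)
  have bd: "a \<le> L \<and> b \<le> L" if "(a, b) \<in> f \<or> (a, b) \<in> g" for a b
    using that path_rels_bounded[OF assms(5)] path_rels_bounded[OF assms(6)] by (auto simp: L_def)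
  have rep: thesis
    if pq: "(p, q) \<in> double n L l f O double n L m g"
      and th: "\<And>c a b d a' b'. c \<in> {l, n + l} \<Longrightarrow> d \<in> {m, n + m} \<Longrightarrow> (a, b) \<in> f \<Longrightarrow> (a', b') \<in> g
      \<Longrightarrow> p = copy_pt n L c a \<Longrightarrow> q = copy_pt n L d b' \<Longrightarrow> copy_pt n L c b = copy_pt n L d a' \<Longrightarrow> thesis"
    for p q thesis
  proof -
    obtain x where x: "(p, x) \<in> double n L l f" "(x, q) \<in> double n L m g" using pq by blast
    obtain c a b where 1: "c \<in> {l, n + l}" "(a, b) \<in> f" "p = copy_pt n L c a" "x = copy_pt n L c b"
      using doubleD[OF x(1)] by blast
    obtain d a' b' where 2: "d \<in> {m, n + m}" "(a', b') \<in> g" "x = copy_pt n L d a'" "q = copy_pt n L d b'"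
      using doubleD[OF x(2)] by blast
    show thesis using th[OF 1(1) 2(1) 1(2) 2(2)] 1 2 by simp
  qed
  have U: "z = z'" if z: "z \<in> double n L l f O double n L m g" "z' \<in> double n L l f O double n L m g" for z z'
  proof -
    obtain p q p' q' where pq: "z = (p, q)" "z' = (p', q')" by fastforce
    obtain c a b d a1 b1 where 1: "c \<in> {l, n + l}" "d \<in> {m, n + m}" "(a, b) \<in> f" "(a1, b1) \<in> g"
      "p = copy_pt n L c a" "q = copy_pt n L d b1" "copy_pt n L c b = copy_pt n L d a1"
      by (rule rep[of p q]) (use z pq in auto)
    obtain c' a' b' d' a1' b1' where 2: "c' \<in> {l, n + l}" "d' \<in> {m, n + m}" "(a', b') \<in> f" "(a1', b1') \<in> g"
      "p' = copy_pt n L c' a'" "q' = copy_pt n L d' b1'" "copy_pt n L c' b' = copy_pt n L d' a1'"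
      by (rule rep[of p' q']) (use z pq in auto)
    have bds: "b \<le> L" "a1 \<le> L" "b' \<le> L" "a1' \<le> L" using bd 1(3,4) 2(3,4) by blast+
    have "b \<in> {0, L}" "a1 \<in> {0, L}" "b' \<in> {0, L}" "a1' \<in> {0, L}"
      using copy_pt_common_end[OF assms(1-3) bds(1,2) 1(1,2,7)] copy_pt_common_end[OF assms(1-3) bds(3,4) 2(1,2,7)] by blast+
    then have aa: "b = b'" "a1 = a1'"
      using path_rels_no_both_ends[OF path_rels_converse[OF assms(5)] assms(4)] path_rels_no_both_ends[OF assms(6,4)] 1(3,4) 2(3,4)
      unfolding L_def by blast+
    then have "c = c'"
      using copy_pt_common_unique[OF assms(1-4) L bds(1,2) 1(1,2,7) 2(1,2)] 2(7) by simp
    moreover have "d = d'"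
      using copy_pt_common_unique[OF assms(2,1) assms(3)[symmetric] assms(4) L bds(2,1) 1(2,1) 1(7)[symmetric] 2(2,1)]
        2(7) aa by simp
    moreover have "a = a'"
      using path_rels_single_valued_conv[OF assms(5,4)] aa 1(3) 2(3) by blast
    moreover have "b1 = b1'"
      using path_rels_single_valued[OF assms(6,4)] aa 1(4) 2(4) by blast
    ultimately show ?thesis using pq aa 1(5,6) 2(5,6) by simp
  qed
  have B: "double n L l f O double n L m g \<subseteq> {..path_len n (Suc h)} \<times> {..path_len n (Suc h)}"
  proof -
    have "double n L l f \<in> path_rels n (Suc h)" "double n L m g \<in> path_rels n (Suc h)"
      using assms by (auto simp: L_def)
    from this[THEN path_rels_bounded] show ?thesis by blast
  qed
  show ?thesis unfolding rank1_def L_def[symmetric]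
    by (intro conjI ballI) (fact B, fact U)
qed

lemma rank1_in_path_rels: "rank1 (path_len n h) f \<Longrightarrow> f \<in> path_rels n h"
  by (cases h) auto

lemma double_in_path_rels: "l < n \<Longrightarrow> f \<in> path_rels n h \<Longrightarrow> double n (path_len n h) l f \<in> path_rels n (Suc h)"
  by auto

lemma path_rels_Int:
  assumes "f \<in> path_rels n h" "g \<in> path_rels n h" "n \<ge> 2"
  shows "f \<inter> g \<in> path_rels n h"
  using assms
proof (induction h arbitrary: f g)
  case 0
  then show ?case using rank1_subset[of 1 f "f \<inter> g"] by simp
next
  case (Suc h)
  show ?case
  proof (cases "rank1 (path_len n (Suc h)) f \<or> rank1 (path_len n (Suc h)) g")
    case True
    then have "rank1 (path_len n (Suc h)) (f \<inter> g)" using rank1_subset by (metis Int_lower1 Int_lower2)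
    then show ?thesis by (rule rank1_in_path_rels)
  next
    case False
    then obtain l f' m g' where 1: "l < n" "f' \<in> path_rels n h" "f = double n (path_len n h) l f'"
      and 2: "m < n" "g' \<in> path_rels n h" "g = double n (path_len n h) m g'"
      using path_rels_SucE[OF Suc.prems(1)] path_rels_SucE[OF Suc.prems(2)] by metis
    show ?thesis
    proof (cases "l = m")
      case True
      then have "f \<inter> g = double n (path_len n h) l (f' \<inter> g')"
        using double_Int[OF 1(1) Suc.prems(3) _ path_rels_bounded[OF 1(2)] path_rels_bounded[OF 2(2)]]
          Suc.prems(3) path_len_pos[of n h] 1(3) 2(3) by simp
      then show ?thesis using double_in_path_rels[OF 1(1) Suc.IH[OF 1(2) 2(2) Suc.prems(3)]] by simp
    next
      case False
      have "rank1 (path_len n (Suc h)) (f \<inter> g)"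
        using rank1_Int_double[OF 1(1) 2(1) False Suc.prems(3) 1(2) 2(2)] 1(3) 2(3) by metis
      then show ?thesis by (rule rank1_in_path_rels)
    qed
  qed
qed

lemma rank1_relcomp:
  assumes "f \<in> path_rels n h" "g \<in> path_rels n h" "n \<ge> 2" "rank1 (path_len n h) f \<or> rank1 (path_len n h) g"
  shows "rank1 (path_len n h) (f O g)"
proof -
  have B: "f O g \<subseteq> {..path_len n h} \<times> {..path_len n h}"
    using path_rels_bounded[OF assms(1)] path_rels_bounded[OF assms(2)] by blast
  have U: "z = z'" if "z \<in> f O g" "z' \<in> f O g" for z z'
    using assms(4)
  proof
    assume "rank1 (path_len n h) f"
    then show ?thesis using that path_rels_single_valued[OF assms(2,3)] unfolding rank1_def
      by (metis relcompE prod.inject)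
  next
    assume "rank1 (path_len n h) g"
    then show ?thesis using that path_rels_single_valued_conv[OF assms(1,3)] unfolding rank1_def
      by (metis relcompE prod.inject)
  qed
  show ?thesis unfolding rank1_def by (intro conjI ballI) (fact B, fact U)
qed

lemma path_rels_relcomp:
  assumes "f \<in> path_rels n h" "g \<in> path_rels n h" "n \<ge> 2"
  shows "f O g \<in> path_rels n h"
  using assms
proof (induction h arbitrary: f g)
  case 0
  then show ?case using rank1_relcomp[of f n 0 g] rank1_in_path_rels[of n 0] by simp
next
  case (Suc h)
  show ?case
  proof (cases "rank1 (path_len n (Suc h)) f \<or> rank1 (path_len n (Suc h)) g")
    case True
    then show ?thesis using Suc.prems rank1_relcomp[of f n "Suc h" g] rank1_in_path_rels by blast
  next
    case False
    then obtain l f' m g' where 1: "l < n" "f' \<in> path_rels n h" "f = double n (path_len n h) l f'"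
      and 2: "m < n" "g' \<in> path_rels n h" "g = double n (path_len n h) m g'"
      using path_rels_SucE[OF Suc.prems(1)] path_rels_SucE[OF Suc.prems(2)] by metis
    show ?thesis
    proof (cases "l = m")
      case True
      then have "f O g = double n (path_len n h) l (f' O g')"
        using double_relcomp[OF 1(1) Suc.prems(3) _ path_rels_bounded[OF 1(2)] path_rels_bounded[OF 2(2)]]
          Suc.prems(3) path_len_pos[of n h] 1(3) 2(3) by simp
      then show ?thesis using double_in_path_rels[OF 1(1) Suc.IH[OF 1(2) 2(2) Suc.prems(3)]] by simp
    next
      case False
      have "rank1 (path_len n (Suc h)) (f O g)"
        using rank1_relcomp_double[OF 1(1) 2(1) False Suc.prems(3) 1(2) 2(2)] 1(3) 2(3) by metis
      then show ?thesis by (rule rank1_in_path_rels)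
    qed
  qed
qed

section \<open>Separation by two-valued functions\<close>

definition admissible :: "'x set \<Rightarrow> ('x \<Rightarrow> (nat \<times> nat) set) \<Rightarrow> (nat \<Rightarrow> bool) \<Rightarrow> bool" where
  "admissible V w \<phi> \<longleftrightarrow> (\<forall>x\<in>V. compatible \<phi> (w x))"

text \<open>
  The first two conditions are what the transfer of identities from \<open>B21\<close> needs. The third one makes
  the induction over the levels work.
\<close>

definition separating :: "nat \<Rightarrow> 'x set \<Rightarrow> ('x \<Rightarrow> (nat \<times> nat) set) \<Rightarrow> bool" where
  "separating N V w \<longleftrightarrow>
     (\<forall>r\<le>N. \<forall>q\<le>N. r \<noteq> q \<longrightarrow> (\<exists>\<phi>. admissible V w \<phi> \<and> \<phi> r \<noteq> \<phi> q)) \<and>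
     (\<forall>x\<in>V. \<forall>r\<le>N. r \<notin> Domain (w x) \<longrightarrow> (\<exists>\<phi>. admissible V w \<phi> \<and> \<phi> r \<notin> \<phi> ` Domain (w x))) \<and>
     (\<forall>t. 0 < t \<and> t < N \<longrightarrow> (\<exists>\<phi>. admissible V w \<phi> \<and> \<phi> t \<noteq> \<phi> 0 \<and> \<phi> t \<noteq> \<phi> N))"

section \<open>Functions compatible with doubled relations\<close>

lemma member_neq: "x \<in> A \<Longrightarrow> y \<notin> A \<Longrightarrow> x \<noteq> y"
  by blast

lemma compatible_rank1:
  assumes "rank1 N y"
  shows "compatible \<phi> y"
proof (cases "y = {}")
  case True
  then show ?thesis by (simp add: compatible_def)
next
  case False
  then obtain a b where "(a, b) \<in> y" by auto
  then have "y = {(a, b)}" using assms unfolding rank1_def by blast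
  then show ?thesis by (auto simp: compatible_def)
qed

text \<open>A negation by \<open>c\<close> is harmless as long as both copies are negated
  alike.\<close>

lemma compatible_double:
  assumes "compatible \<psi> y" "y \<subseteq> {..L} \<times> {..L}"
    and "\<And>t. t \<le> L \<Longrightarrow> \<phi> (copy_pt n L l t) = (\<psi> t \<noteq> c)" "\<And>t. t \<le> L \<Longrightarrow> \<phi> (copy_pt n L (n + l) t) = (\<psi> t \<noteq> c)"
  shows "compatible \<phi> (double n L l y)"
proof -
  have *: "\<exists>a b. (a, b) \<in> y \<and> \<phi> p = (\<psi> a \<noteq> c) \<and> \<phi> q = (\<psi> b \<noteq> c)" if pq: "(p, q) \<in> double n L l y" for p q
  proof -
    obtain e a b where "e \<in> {l, n + l}" "(a, b) \<in> y" "p = copy_pt n L e a" "q = copy_pt n L e b"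
      using doubleD[OF pq] by blast
    then show ?thesis using assms(2-4) by blast
  qed
  show ?thesis
  proof (cases "\<forall>(a, b)\<in>y. \<psi> a = \<psi> b")
    case True
    then show ?thesis using * unfolding compatible_def by fast
  next
    case False
    then obtain d where "\<forall>(a, b)\<in>y. \<psi> a = d \<and> \<psi> b = (\<not> d)"
      using assms(1) unfolding compatible_def by blast
    then have "\<forall>(p, q)\<in>double n L l y. \<phi> p = (d \<noteq> c) \<and> \<phi> q = (\<not> (d \<noteq> c))"
      using * by fast
    then show ?thesis unfolding compatible_def by blast
  qed
qed

text \<open>The two constants may differ, since every pair of a doubled relation stays inside one
  copy.\<close>

lemma compatible_const:
  assumes "y \<subseteq> {..L} \<times> {..L}"
    and "\<And>t. t \<le> L \<Longrightarrow> \<phi> (copy_pt n L l t) = c" "\<And>t. t \<le> L \<Longrightarrow> \<phi> (copy_pt n L (n + l) t) = d"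
  shows "compatible \<phi> (double n L l y)"
proof -
  have "\<phi> p = \<phi> q" if pq: "(p, q) \<in> double n L l y" for p q
  proof -
    obtain e a b where "e \<in> {l, n + l}" "(a, b) \<in> y" "p = copy_pt n L e a" "q = copy_pt n L e b"
      using doubleD[OF pq] by blast
    then show ?thesis using assms by blast
  qed
  then show ?thesis unfolding compatible_def by blast
qed

text \<open>
  A family of relations on the long path that leaves block \<open>i\<close> untouched, apart from relations with at
  most one pair, which are compatible with every \<open>\<phi>\<close>.
\<close>

locale block_family =
  fixes n L :: nat and V :: "'x set" and w f :: "'x \<Rightarrow> (nat \<times> nat) set" and bl :: "'x \<Rightarrow> nat" and i :: nat
  assumes n: "3 \<le> n" and L: "0 < L" and i: "i < n"
    and big: "\<And>x. x \<in> V \<Longrightarrow> \<not> rank1 (2 * n * L) (w x) \<Longrightarrow>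
      bl x < n \<and> bl x \<noteq> i \<and> w x = double n L (bl x) (f x) \<and> f x \<subseteq> {..L} \<times> {..L} \<and>
      \<not> (0 \<in> Domain (f x) \<and> L \<in> Domain (f x))"
begin

text \<open>Relations on other blocks become empty instead of being dropped. The family keeps the
  index set \<open>V\<close>, so the bound on its cardinality survives the passage to the lower
  level.\<close>

definition block_part :: "nat \<Rightarrow> 'x \<Rightarrow> (nat \<times> nat) set" where
  "block_part l x = (if \<not> rank1 (2 * n * L) (w x) \<and> bl x = l then f x else {})"

lemma admissibleI:
  assumes "\<And>x. x \<in> V \<Longrightarrow> \<not> rank1 (2 * n * L) (w x) \<Longrightarrow> compatible \<phi> (double n L (bl x) (f x))"
  shows "admissible V w \<phi>"
  unfolding admissible_def using assms big compatible_rank1 by metis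

lemma admissible_block_part_compatible:
  assumes "admissible V (block_part l) \<psi>" "x \<in> V" "\<not> rank1 (2 * n * L) (w x)" "bl x = l"
  shows "compatible \<psi> (f x)"
  using assms unfolding admissible_def block_part_def by auto

lemma admissible_fold_pt:
  assumes "m < n" "admissible V (block_part m) \<psi>"
  shows "admissible V w (\<lambda>p. \<psi> (fold_pt n L m p))"
proof (rule admissibleI)
  fix x assume x: "x \<in> V" "\<not> rank1 (2 * n * L) (w x)"
  note b = big[OF this]
  show "compatible (\<lambda>p. \<psi> (fold_pt n L m p)) (double n L (bl x) (f x))"
  proof (cases "bl x = m")
    case True
    then show ?thesis
      using admissible_block_part_compatible[OF assms(2) x True] b fold_pt_copy_pt[of m n] assms(1)
      by (intro compatible_double[where \<psi> = \<psi> and c = False]) auto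
  next
    case False
    then show ?thesis
      using b fold_pt_copy_pt_other[of "bl x" n m] assms(1)
      by (intro compatible_const[where c = "\<psi> (if m < bl x then L else 0)" and d = "\<psi> (if bl x < m then L else 0)"]) auto
  qed
qed

text \<open>
  Between the two copies of a flipped block, the value must change an even number of times in other
  blocks; on a block that is not flipped, the function is constant on each copy. So the number of
  flipped blocks has to be odd.
\<close>

lemma admissible_three:
  assumes "l < n" "m < n" "k < n" "l \<noteq> m" "m \<noteq> k" "k \<noteq> l"
    and "admissible V (block_part l) \<psi>l" "admissible V (block_part m) \<psi>m" "admissible V (block_part k) \<psi>k"
    and "\<psi>l 0 \<noteq> \<psi>l L" "\<psi>m 0 \<noteq> \<psi>m L" "\<psi>k 0 \<noteq> \<psi>k L"
  shows "admissible V w (\<lambda>p. (\<psi>l (fold_pt n L l p) \<noteq> \<psi>m (fold_pt n L m p)) \<noteq> \<psi>k (fold_pt n L k p))" (is "admissible V w ?\<phi>")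
proof (rule admissibleI)
  fix x assume x: "x \<in> V" "\<not> rank1 (2 * n * L) (w x)"
  note b = big[OF this]
  have two: "(\<psi>a (if a < c then L else 0) \<noteq> \<psi>b (if b < c then L else 0)) =
    (\<psi>a (if c < a then L else 0) \<noteq> \<psi>b (if c < b then L else 0))"
    if "a \<noteq> c" "b \<noteq> c" "\<psi>a 0 \<noteq> \<psi>a L" "\<psi>b 0 \<noteq> \<psi>b L" for a b c :: nat and \<psi>a \<psi>b :: "nat \<Rightarrow> bool"
    using that by auto
  consider "bl x = l" | "bl x = m" | "bl x = k" | "bl x \<notin> {l, m, k}" by blast
  then show "compatible ?\<phi> (double n L (bl x) (f x))"
  proof cases
    case 1
    show ?thesis
      using admissible_block_part_compatible[OF assms(7) x 1] b 1 assms two[of m l k \<psi>m \<psi>k]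
      by (intro compatible_double[where \<psi> = \<psi>l and c = "\<psi>m (if m < l then L else 0) \<noteq> \<psi>k (if k < l then L else 0)"])
        (simp_all add: fold_pt_copy_pt fold_pt_copy_pt_other, blast+)
  next
    case 2
    show ?thesis
      using admissible_block_part_compatible[OF assms(8) x 2] b 2 assms two[of l m k \<psi>l \<psi>k]
      by (intro compatible_double[where \<psi> = \<psi>m and c = "\<psi>l (if l < m then L else 0) \<noteq> \<psi>k (if k < m then L else 0)"])
        (simp_all add: fold_pt_copy_pt fold_pt_copy_pt_other, blast+)
  next
    case 3
    show ?thesis
      using admissible_block_part_compatible[OF assms(9) x 3] b 3 assms two[of l k m \<psi>l \<psi>m]
      by (intro compatible_double[where \<psi> = \<psi>k and c = "\<psi>l (if l < k then L else 0) \<noteq> \<psi>m (if m < k then L else 0)"])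
        (simp_all add: fold_pt_copy_pt fold_pt_copy_pt_other, blast+)
  next
    case 4
    let ?e = "\<lambda>a. if a < bl x then L else 0" let ?d = "\<lambda>a. if bl x < a then L else 0"
    show ?thesis
      using 4 b assms(1-3)
      by (intro compatible_const[where c = "(\<psi>l (?e l) \<noteq> \<psi>m (?e m)) \<noteq> \<psi>k (?e k)"
             and d = "(\<psi>l (?d l) \<noteq> \<psi>m (?d m)) \<noteq> \<psi>k (?d k)"])
        (simp_all add: fold_pt_copy_pt_other)
  qed
qed

text \<open>The value changes just after the left end of the first copy of block \<open>i\<close>,
  hence inside that copy, where no relation with several pairs lives. Unlike the pullbacks along
  retractions, this function separates the two ends of the path.\<close>

lemma admissible_cut_low: "admissible V w (\<lambda>p. p \<le> i * L)"
proof (rule admissibleI)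
  fix x assume x: "x \<in> V" "\<not> rank1 (2 * n * L) (w x)"
  note b = big[OF this]
  have "i * L + L \<le> n * L" using less_mult_step[OF i] .
  then have 2: "\<not> copy_pt n L (n + bl x) t \<le> i * L" if "t \<le> L" for t
    using that b copy_pt_le(2)[of "bl x" n t L] L by linarith
  consider "bl x < i" | "i < bl x" using b by linarith
  then have 1: "copy_pt n L (bl x) t \<le> i * L \<longleftrightarrow> bl x < i" if "t \<le> L" for t
  proof cases
    case 1 then show ?thesis using less_mult_step[OF 1, of L] that b by (simp add: copy_pt_less)
  next
    case 2 then show ?thesis using less_mult_step[OF 2, of L] that b L by (simp add: copy_pt_less)
  qed
  show "compatible (\<lambda>p. p \<le> i * L) (double n L (bl x) (f x))"
    using b 1 2 by (intro compatible_const[where c = "bl x < i" and d = False]) simp_all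
qed

text \<open>The mirror image: the value changes just before the right end of the second copy of
  block \<open>i\<close>.\<close>

lemma admissible_cut_high: "admissible V w (\<lambda>p. n * L + i * L + L \<le> p)"
proof (rule admissibleI)
  fix x assume x: "x \<in> V" "\<not> rank1 (2 * n * L) (w x)"
  note b = big[OF this]
  have 2: "\<not> n * L + i * L + L \<le> copy_pt n L (bl x) t" if "t \<le> L" for t
    using that b copy_pt_le(1)[of "bl x" n t L] L by linarith
  consider "bl x < i" | "i < bl x" using b by linarith
  then have 1: "n * L + i * L + L \<le> copy_pt n L (n + bl x) t \<longleftrightarrow> i < bl x" if "t \<le> L" for t
  proof cases
    case 1 then show ?thesis using less_mult_step[OF 1, of L] that b L unfolding copy_pt_ge by linarith
  next
    case 2 then show ?thesis using less_mult_step[OF 2, of L] that b L unfolding copy_pt_ge by linarith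
  qed
  show "compatible (\<lambda>p. n * L + i * L + L \<le> p) (double n L (bl x) (f x))"
    using b 1 2 by (intro compatible_const[where c = False and d = "i < bl x"]) simp_all
qed

lemma separate_points:
  assumes IH: "\<And>l. l < n \<Longrightarrow> separating L V (block_part l)" and "r \<le> 2 * n * L" "q \<le> 2 * n * L" "r \<noteq> q"
  shows "\<exists>\<phi>. admissible V w \<phi> \<and> \<phi> r \<noteq> \<phi> q"
proof -
  have *: "\<exists>\<phi>. admissible V w \<phi> \<and> \<phi> r \<noteq> \<phi> q" if rq: "r < q" "q \<le> 2 * n * L" for r q
  proof (cases "\<exists>m<n. fold_pt n L m r \<noteq> fold_pt n L m q")
    case True
    then obtain m where m: "m < n" "fold_pt n L m r \<noteq> fold_pt n L m q" by blast
    then obtain \<psi> where "admissible V (block_part m) \<psi>" "\<psi> (fold_pt n L m r) \<noteq> \<psi> (fold_pt n L m q)"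
      using IH[OF m(1)] fold_pt_le[of n L m r] fold_pt_le[of n L m q] unfolding separating_def by blast
    then show ?thesis using admissible_fold_pt[OF m(1)] by blast
  next
    case False
    then have "r = 0" "q = n * L + n * L"
      using fold_pt_inj[OF rq L] n by (auto simp: mult_2 distrib_right)
    moreover have "i * L + L \<le> n * L" using less_mult_step[OF i] .
    ultimately show ?thesis using admissible_cut_low L by (intro exI conjI) auto
  qed
  show ?thesis
    using *[of r q] *[of q r] assms(2-4) by (metis nat_neq_iff)
qed

lemma separating_flip:
  assumes "separating L V u"
  shows "\<exists>\<psi>. admissible V u \<psi> \<and> \<psi> 0 \<noteq> \<psi> L"
  using assms L unfolding separating_def by (metis le_refl less_imp_neq zero_le)

text \<open>Both ends retract to 0, so separating the retracted point from 0 separates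
  \<open>t\<close> from both of them at once.\<close>

lemma separate_interior:
  assumes IH: "\<And>l. l < n \<Longrightarrow> separating L V (block_part l)" and t: "0 < t" "t < 2 * n * L"
  shows "\<exists>\<phi>. admissible V w \<phi> \<and> \<phi> t \<noteq> \<phi> 0 \<and> \<phi> t \<noteq> \<phi> (2 * n * L)"
proof -
  obtain m where m: "m < n" "fold_pt n L m t \<noteq> 0"
    using fold_pt_inj[of 0 t n L] t L n by (force simp: fold_pt_0)
  then obtain \<psi> where \<psi>: "admissible V (block_part m) \<psi>" "\<psi> (fold_pt n L m t) \<noteq> \<psi> 0"
    using IH[OF m(1)] fold_pt_le[of n L m t] unfolding separating_def by (metis zero_le)
  show ?thesis
    using admissible_fold_pt[OF m(1) \<psi>(1)] \<psi>(2) fold_pt_0 fold_pt_last[OF m(1)] by (intro exI conjI) auto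
qed

text \<open>
  If \<open>r\<close> is an end point of a copy and no three flipped blocks separate it from block \<open>l\<close>, then \<open>r\<close> is
  an end point of the whole path. Those are the cases where the missing block \<open>i\<close> has to be cut.
\<close>

lemma junction_cases:
  assumes l: "l < n" and l': "l' < n" "l' \<noteq> l" and t: "t = 0 \<or> t = L"
    and r: "r = copy_pt n L l' t \<or> r = copy_pt n L (n + l') t"
    and out: "\<And>c a. c \<in> {l, n + l} \<Longrightarrow> a \<le> L \<Longrightarrow> r \<noteq> copy_pt n L c a"
    and all: "(\<forall>b<n. b \<noteq> l \<longrightarrow> (fold_pt n L b r = L) = (b < l)) \<or> (\<forall>b<n. b \<noteq> l \<longrightarrow> (fold_pt n L b r = L) \<noteq> (b < l))"
  shows "(l = 0 \<and> r = n * L + n * L) \<or> (l = n - 1 \<and> r = 0)"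
proof -
  have tL: "t \<le> L" using t by auto
  have n1: "(n - 1) * L + L = n * L" using n by (cases n) auto
  have ol: "r \<noteq> l * L" "r \<noteq> l * L + L" "r \<noteq> n * L + l * L + L" "r \<noteq> n * L + l * L"
    using out[of l 0] out[of l L] out[of "n + l" 0] out[of "n + l" L] l by (simp_all add: copy_pt_less copy_pt_ge)
  show ?thesis
    using r
  proof
    assume r: "r = copy_pt n L l' t"
    then have rv: "r = l' * L + t" using l' by (simp add: copy_pt_less)
    have R: "(fold_pt n L b r = L) = (if b = l' then t = L else b < l')" if "b < n" for b
      using that fold_pt_copy_pt(1)[OF l'(1) tL] fold_pt_copy_pt_other(1)[OF l'(1) that _ tL] r L by auto
    show ?thesis
      using all
    proof
      assume a: "\<forall>b<n. b \<noteq> l \<longrightarrow> (fold_pt n L b r = L) = (b < l)"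
      show ?thesis
      proof (cases "l' < l")
        case True
        then have "t = L" using a R[of l'] l' by auto
        have "Suc l' = l" using a[rule_format, of "Suc l'"] R[of "Suc l'"] True l by (auto split: if_splits)
        then show ?thesis using ol rv \<open>t = L\<close> by auto
      next
        case False
        then have "t = 0" using a R[of l'] l' t by auto
        have "l' = Suc l" using a[rule_format, of "Suc l"] R[of "Suc l"] False l' by (auto split: if_splits)
        then show ?thesis using ol rv \<open>t = 0\<close> by auto
      qed
    next
      assume a: "\<forall>b<n. b \<noteq> l \<longrightarrow> (fold_pt n L b r = L) \<noteq> (b < l)"
      show ?thesis
      proof (cases "l' < l")
        case True
        then have "t = 0" using a R[of l'] l' t by auto
        have "l' = 0" using a[rule_format, of 0] R[of 0] True n by (cases "l' = 0") (auto split: if_splits)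
        moreover have "l = n - 1" using a[rule_format, of "n - 1"] R[of "n - 1"] True l n
          by (intro ccontr[of "_ = n - 1"]) (auto split: if_splits)
        ultimately show ?thesis using rv \<open>t = 0\<close> by auto
      next
        case False
        then have "t = L" using a R[of l'] l' t by auto
        have "l = 0" using a[rule_format, of 0] R[of 0] False l' n by (cases "l = 0") (auto split: if_splits)
        moreover have "l' = n - 1" using a[rule_format, of "n - 1"] R[of "n - 1"] False l' l n
          by (intro ccontr[of "_ = n - 1"]) (auto split: if_splits)
        ultimately show ?thesis using rv \<open>t = L\<close> ol n1 by auto
      qed
    qed
  next
    assume r: "r = copy_pt n L (n + l') t"
    then have rv: "r = n * L + l' * L + L - t" using l' by (simp add: copy_pt_ge)
    have R: "(fold_pt n L b r = L) = (if b = l' then t = L else l' < b)" if "b < n" for b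
      using that fold_pt_copy_pt(2)[OF l'(1) tL] fold_pt_copy_pt_other(2)[OF l'(1) that _ tL] r L by auto
    show ?thesis
      using all
    proof
      assume a: "\<forall>b<n. b \<noteq> l \<longrightarrow> (fold_pt n L b r = L) = (b < l)"
      show ?thesis
      proof (cases "l' < l")
        case True
        then have "t = L" using a R[of l'] l' by auto
        have "l' = 0" using a[rule_format, of 0] R[of 0] True n by (cases "l' = 0") (auto split: if_splits)
        moreover have "l = n - 1" using a[rule_format, of "n - 1"] R[of "n - 1"] True l n
          by (intro ccontr[of "_ = n - 1"]) (auto split: if_splits)
        ultimately show ?thesis using rv \<open>t = L\<close> ol n1 by auto
      next
        case False
        then have "t = 0" using a R[of l'] l' t by auto
        have "l = 0" using a[rule_format, of 0] R[of 0] False l' n by (cases "l = 0") (auto split: if_splits)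
        moreover have "l' = n - 1" using a[rule_format, of "n - 1"] R[of "n - 1"] False l' l n
          by (intro ccontr[of "_ = n - 1"]) (auto split: if_splits)
        ultimately show ?thesis using rv \<open>t = 0\<close> n1 by auto
      qed
    next
      assume a: "\<forall>b<n. b \<noteq> l \<longrightarrow> (fold_pt n L b r = L) \<noteq> (b < l)"
      show ?thesis
      proof (cases "l' < l")
        case True
        then have "t = 0" using a R[of l'] l' t by auto
        have "Suc l' = l" using a[rule_format, of "Suc l'"] R[of "Suc l'"] True l by (auto split: if_splits)
        then show ?thesis using ol rv \<open>t = 0\<close> by auto
      next
        case False
        then have "t = L" using a R[of l'] l' t by auto
        have "l' = Suc l" using a[rule_format, of "Suc l"] R[of "Suc l"] False l' by (auto split: if_splits)
        then show ?thesis using ol rv \<open>t = L\<close> by auto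
      qed
    qed
  qed
qed

text \<open>A pullback from block \<open>l\<close> fails only if \<open>r\<close> lies off that
  block while its retraction hits the domain of \<open>f x\<close>; this retraction is then an end
  point. If \<open>r\<close> is interior to a copy of another block, that block helps, because all
  of block \<open>l\<close> retracts to its two ends. A junction needs three flipped blocks or a
  cut.\<close>

lemma separate_domain:
  assumes IH: "\<And>l. l < n \<Longrightarrow> separating L V (block_part l)"
    and x: "x \<in> V" and r: "r \<le> 2 * n * L" "r \<notin> Domain (w x)"
  shows "\<exists>\<phi>. admissible V w \<phi> \<and> \<phi> r \<notin> \<phi> ` Domain (w x)"
proof (cases "rank1 (2 * n * L) (w x)")
  case True
  show ?thesis
  proof (cases "w x = {}")
    case True
    then show ?thesis using admissible_cut_low by auto
  next
    case False
    then obtain d d' where "(d, d') \<in> w x" by auto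
    then have d: "w x = {(d, d')}" "d \<le> 2 * n * L" using True unfolding rank1_def by auto
    then obtain \<phi> where "admissible V w \<phi>" "\<phi> r \<noteq> \<phi> d"
      using separate_points[OF IH, of r d] r by auto
    then show ?thesis using d by auto
  qed
next
  case False
  define l where "l = bl x"
  note b = big[OF x False, folded l_def]
  have D: "Domain (w x) = copy_pt n L l ` Domain (f x) \<union> copy_pt n L (n + l) ` Domain (f x)"
    using b Domain_double by metis
  have fL: "a \<le> L" if "a \<in> Domain (f x)" for a using that b by auto
  have block_part: "block_part l x = f x" using False by (simp add: block_part_def l_def)
  show ?thesis
  proof (cases "fold_pt n L l r \<in> Domain (f x)")
    case False
    then obtain \<psi> where \<psi>: "admissible V (block_part l) \<psi>" "\<psi> (fold_pt n L l r) \<notin> \<psi> ` Domain (f x)"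
      using IH[of l] b x block_part fold_pt_le[of n L l r] unfolding separating_def by metis
    have "fold_pt n L l p \<in> Domain (f x)" if p: "p \<in> Domain (w x)" for p
    proof -
      obtain a where "a \<in> Domain (f x)" "p = copy_pt n L l a \<or> p = copy_pt n L (n + l) a"
        using p unfolding D by blast
      then show ?thesis using fL fold_pt_copy_pt[of l n a L] b by auto
    qed
    then have "\<psi> (fold_pt n L l r) \<notin> (\<lambda>p. \<psi> (fold_pt n L l p)) ` Domain (w x)"
      using \<psi>(2) by blast
    then show ?thesis using admissible_fold_pt[OF _ \<psi>(1)] b by (intro exI conjI) auto
  next
    case True
    define e where "e = fold_pt n L l r"
    have e: "e \<in> Domain (f x)" using True by (simp add: e_def)
    have out: "r \<noteq> copy_pt n L c a" if "c \<in> {l, n + l}" "a \<le> L" for c a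
    proof
      assume "r = copy_pt n L c a"
      moreover then have "a = e" using that b fold_pt_copy_pt[of l n a L] by (auto simp: e_def)
      ultimately show False using r(2) D e that by auto
    qed
    obtain l' t where l': "l' < n" "t \<le> L" "r = copy_pt n L l' t \<or> r = copy_pt n L (n + l') t"
      using copy_pt_surj[OF r(1) L] n by auto
    have ll: "l' \<noteq> l" using out[of _ t] l' by auto
    have e0L: "e = 0 \<or> e = L"
      using fold_pt_copy_pt_other[of l' n l t L] l' ll b by (auto simp: e_def split: if_splits)
    show ?thesis
    proof (cases "0 < t \<and> t < L")
      case True
      then obtain \<psi> where \<psi>: "admissible V (block_part l') \<psi>" "\<psi> t \<noteq> \<psi> 0" "\<psi> t \<noteq> \<psi> L"
        using IH[OF l'(1)] unfolding separating_def by blast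
      have "fold_pt n L l' r = t" using fold_pt_copy_pt[of l' n t L] l' by auto
      moreover have "fold_pt n L l' p = 0 \<or> fold_pt n L l' p = L" if p: "p \<in> Domain (w x)" for p
      proof -
        obtain a where "a \<in> Domain (f x)" "p = copy_pt n L l a \<or> p = copy_pt n L (n + l) a"
          using p unfolding D by blast
        then show ?thesis using fL[of a] fold_pt_copy_pt_other[of l n l' a L] l' ll b by auto
      qed
      ultimately have "\<psi> (fold_pt n L l' r) \<noteq> \<psi> (fold_pt n L l' p)" if "p \<in> Domain (w x)" for p
        using \<psi>(2,3) that by metis
      then have "\<psi> (fold_pt n L l' r) \<notin> (\<lambda>p. \<psi> (fold_pt n L l' p)) ` Domain (w x)" by blast
      then show ?thesis using admissible_fold_pt[OF l'(1) \<psi>(1)] by (intro exI conjI) auto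
    next
      case False
      then have t: "t = 0 \<or> t = L" using l' by auto
      have P: "fold_pt n L b r = 0 \<or> fold_pt n L b r = L" if "b < n" for b
        using fold_pt_copy_pt[of l' n t L] fold_pt_copy_pt_other[of l' n b t L] l' t that
        by (cases "b = l'") (auto split: if_splits)
      consider (three) m k where "m < n" "m \<noteq> l" "(fold_pt n L m r = L) = (m < l)"
          "k < n" "k \<noteq> l" "(fold_pt n L k r = L) \<noteq> (k < l)"
        | (ends) "(\<forall>b<n. b \<noteq> l \<longrightarrow> (fold_pt n L b r = L) = (b < l)) \<or> (\<forall>b<n. b \<noteq> l \<longrightarrow> (fold_pt n L b r = L) \<noteq> (b < l))"
        by blast
      then show ?thesis
      proof cases
        case three
        \<comment> \<open>At \<open>r\<close>, the retraction onto \<open>m\<close> takes its value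
          on the first copy of block \<open>l\<close>, and the retraction onto \<open>k\<close> its
          value on the second. Between the two copies both values change and the changes cancel,
          whereas \<open>r\<close> differs from either copy in exactly one of them.\<close>
        have mk: "m \<noteq> k" using three by auto
        \<comment> \<open>The other end of the short path. It lies outside the domain of
          \<open>f x\<close>, so a function that keeps it apart from this domain is constant on the
          domain and flips between the ends.\<close>
        define e' where "e' = L - e"
        have e': "e' \<le> L" "e' \<notin> Domain (f x)" "e = 0 \<and> e' = L \<or> e = L \<and> e' = 0"
          using e e0L b by (auto simp: e'_def)
        then obtain \<psi> where \<psi>: "admissible V (block_part l) \<psi>" "\<psi> e' \<notin> \<psi> ` Domain (f x)"
          using IH[of l] b x block_part unfolding separating_def by metis
        have \<psi>f: "\<psi> 0 \<noteq> \<psi> L" using \<psi> e e' by auto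
        have \<psi>e: "\<psi> a = \<psi> e" if "a \<in> Domain (f x)" for a
        proof -
          from member_neq[OF imageI[OF that] \<psi>(2)] member_neq[OF imageI[OF e] \<psi>(2)] show ?thesis by blast
        qed
        obtain \<psi>m where \<psi>m: "admissible V (block_part m) \<psi>m" "\<psi>m 0 \<noteq> \<psi>m L" using separating_flip[OF IH[OF three(1)]] by blast
        obtain \<psi>k where \<psi>k: "admissible V (block_part k) \<psi>k" "\<psi>k 0 \<noteq> \<psi>k L" using separating_flip[OF IH[OF three(4)]] by blast
        let ?\<phi> = "\<lambda>p. (\<psi> (fold_pt n L l p) \<noteq> \<psi>m (fold_pt n L m p)) \<noteq> \<psi>k (fold_pt n L k p)"
        have ad: "admissible V w ?\<phi>"
          using admissible_three[of l m k \<psi> \<psi>m \<psi>k] three mk b \<psi> \<psi>f \<psi>m \<psi>k by auto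
        have rm: "fold_pt n L m r = (if m < l then L else 0)" using three P[of m] L by auto
        have rk: "fold_pt n L k r = (if k < l then 0 else L)" using three P[of k] L by auto
        have "?\<phi> r \<noteq> ?\<phi> p" if p: "p \<in> Domain (w x)" for p
        proof -
          obtain a where a: "a \<in> Domain (f x)" "p = copy_pt n L l a \<or> p = copy_pt n L (n + l) a"
            using p unfolding D by blast
          note aL = fL[OF a(1)]
          have pl: "fold_pt n L l p = a" using a(2) fold_pt_copy_pt[of l n a L] b aL by auto
          have "fold_pt n L m p = (if m < l then L else 0) \<and> fold_pt n L k p = (if k < l then L else 0) \<or>
            fold_pt n L m p = (if m < l then 0 else L) \<and> fold_pt n L k p = (if k < l then 0 else L)"
            using a(2) fold_pt_copy_pt_other[of l n m a L] fold_pt_copy_pt_other[of l n k a L] three b aL by auto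
          moreover have "\<psi> (fold_pt n L l r) = \<psi> e" "\<psi> (fold_pt n L l p) = \<psi> e"
            using pl \<psi>e a by (auto simp: e_def)
          ultimately show ?thesis using rm rk \<psi>m(2) \<psi>k(2) by (auto split: if_splits)
        qed
        then have "?\<phi> r \<notin> ?\<phi> ` Domain (w x)" by blast
        then show ?thesis using ad by blast
      next
        case ends
        have iL: "i * L + L \<le> n * L" using less_mult_step[OF i] .
        \<comment> \<open>Since block \<open>i\<close> differs from block \<open>l\<close>, a cut
          inside block \<open>i\<close> leaves both copies of block \<open>l\<close> on the side
          opposite to \<open>r\<close>.\<close>
        consider "l = 0" "r = n * L + n * L" | "l = n - 1" "r = 0"
          using junction_cases[OF _ l'(1) ll t l'(3) out ends] b by blast
        then show ?thesis
        proof cases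
          case 1
          let ?\<phi> = "\<lambda>p. n * L + i * L + L \<le> p"
          have "0 < i" using b 1 by auto
          then have Li: "L \<le> i * L" by simp
          have "\<not> ?\<phi> p" if p: "p \<in> Domain (w x)" for p
          proof -
            obtain a where a: "a \<in> Domain (f x)" "p = copy_pt n L l a \<or> p = copy_pt n L (n + l) a"
              using p unfolding D by blast
            then have "p = a \<or> p = n * L + L - a"
              using copy_pt_less[of 0 n L a] copy_pt_ge[of n L 0 a] n 1(1) by auto
            then show ?thesis using fL[OF a(1)] Li L by - (elim disjE; linarith)
          qed
          moreover have "?\<phi> r" using 1 iL by simp
          ultimately have "?\<phi> r \<notin> ?\<phi> ` Domain (w x)" by blast
          then show ?thesis using admissible_cut_high by blast
        next
          case 2
          let ?\<phi> = "\<lambda>p. p \<le> i * L"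
          have "i < l" using b 2 i by auto
          then have "i * L + L \<le> l * L" by (rule less_mult_step)
          moreover have "l * L + L \<le> n * L" using less_mult_step b by blast
          ultimately have "\<not> ?\<phi> p" if p: "p \<in> Domain (w x)" for p
          proof -
            obtain a where a: "a \<in> Domain (f x)" "p = copy_pt n L l a \<or> p = copy_pt n L (n + l) a"
              using p unfolding D by blast
            then have "p = l * L + a \<or> p = n * L + l * L + L - a"
              using copy_pt_less[of l n L a] copy_pt_ge[of n L l a] b by auto
            then show ?thesis
              using fL[OF a(1)] \<open>i * L + L \<le> l * L\<close> \<open>l * L + L \<le> n * L\<close> L by - (elim disjE; linarith)
          qed
          moreover have "?\<phi> r" using 2 by simp
          ultimately have "?\<phi> r \<notin> ?\<phi> ` Domain (w x)" by blast
          then show ?thesis using admissible_cut_low by blast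
        qed
      qed
    qed
  qed
qed

lemma separating_step:
  assumes "\<And>l. l < n \<Longrightarrow> separating L V (block_part l)"
  shows "separating (2 * n * L) V w"
  unfolding separating_def
proof (intro conjI allI ballI impI)
  fix r q assume "r \<le> 2 * n * L" "q \<le> 2 * n * L" "r \<noteq> q"
  then show "\<exists>\<phi>. admissible V w \<phi> \<and> \<phi> r \<noteq> \<phi> q" using separate_points[OF assms] by simp
next
  fix x r assume "x \<in> V" "r \<le> 2 * n * L" "r \<notin> Domain (w x)"
  then show "\<exists>\<phi>. admissible V w \<phi> \<and> \<phi> r \<notin> \<phi> ` Domain (w x)" using separate_domain[OF assms] by simp
next
  fix t assume "0 < t \<and> t < 2 * n * L"
  then show "\<exists>\<phi>. admissible V w \<phi> \<and> \<phi> t \<noteq> \<phi> 0 \<and> \<phi> t \<noteq> \<phi> (2 * n * L)"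
    using separate_interior[OF assms] by simp
qed

end

text \<open>By the pigeonhole principle, fewer than \<open>n\<close> relations leave some block
  free. The free block is chosen anew for each family of block parts. At level 0 every relation has
  at most one pair, so every function is admissible.\<close>

lemma separating_path_rels:
  assumes "finite V" "card V < n" "3 \<le> n" "\<And>x. x \<in> V \<Longrightarrow> w x \<in> path_rels n h"
  shows "separating (path_len n h) V w"
  using assms(4)
proof (induction h arbitrary: w)
  case 0
  have g: "admissible V w \<phi>" for \<phi> unfolding admissible_def using 0 compatible_rank1 by (metis mem_Collect_eq path_rels.simps(1))
  have "\<exists>\<phi>. admissible V w \<phi> \<and> \<phi> r \<notin> \<phi> ` Domain (w x)" if "x \<in> V" "r \<notin> Domain (w x)" for x r
    using that by (intro exI[of _ "\<lambda>p. p = r"] conjI g) auto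
  moreover have "\<exists>\<phi>. admissible V w \<phi> \<and> \<phi> r \<noteq> \<phi> q" if "r \<noteq> q" for r q
    using that by (intro exI[of _ "\<lambda>p. p = r"] conjI g) auto
  ultimately show ?case unfolding separating_def by (auto simp: less_Suc0)
next
  case (Suc h)
  let ?L = "path_len n h" let ?N = "path_len n (Suc h)"
  have "\<forall>x\<in>V. \<exists>l f. \<not> rank1 ?N (w x) \<longrightarrow> l < n \<and> f \<in> path_rels n h \<and> w x = double n ?L l f"
    using path_rels_SucE[OF Suc.prems] by metis
  then obtain bl f where bf: "\<And>x. x \<in> V \<Longrightarrow> \<not> rank1 ?N (w x) \<Longrightarrow> bl x < n \<and> f x \<in> path_rels n h \<and> w x = double n ?L (bl x) (f x)"
    by metis
  have "card (bl ` V) < n" using card_image_le[OF assms(1), of bl] assms(2) by linarith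
  then have "\<not> {..<n} \<subseteq> bl ` V" using card_mono[OF finite_imageI[OF assms(1)], of "{..<n}" bl] by auto
  then obtain i where i: "i < n" "i \<notin> bl ` V" by auto
  have N: "?N = 2 * n * ?L" by simp
  interpret block_family n ?L V w f bl i
  proof
    show "3 \<le> n" "i < n" by fact+
    show "0 < ?L" using path_len_pos assms by simp
    fix x assume x: "x \<in> V" "\<not> rank1 (2 * n * ?L) (w x)"
    note b = bf[OF x(1) x(2)[folded N]]
    show "bl x < n \<and> bl x \<noteq> i \<and> w x = double n ?L (bl x) (f x) \<and> f x \<subseteq> {..?L} \<times> {..?L} \<and>
      \<not> (0 \<in> Domain (f x) \<and> ?L \<in> Domain (f x))"
      using b i(2) x(1) path_rels_bounded[of "f x" n h] path_rels_no_both_ends[of "f x" n h] assms(3)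
      by (intro conjI) auto
  qed
  have "separating ?L V (block_part l)" if "l < n" for l
  proof (rule Suc.IH)
    fix x assume "x \<in> V"
    then show "block_part l x \<in> path_rels n h"
      using bf[of x] rank1_in_path_rels[of n h "{}"] unfolding block_part_def N by (auto simp: rank1_def)
  qed
  from separating_step[OF this] show ?case unfolding N .
qed

section \<open>Finite block-groups\<close>

text \<open>The exponent is shifted: \<open>power_Suc m x k\<close> is the power of \<open>x\<close> with exponent \<open>k + 1\<close>.\<close>

primrec power_Suc :: "('a \<Rightarrow> 'a \<Rightarrow> 'a) \<Rightarrow> 'a \<Rightarrow> nat \<Rightarrow> 'a" where
  "power_Suc m x 0 = x"
| "power_Suc m x (Suc k) = m (power_Suc m x k) x"

locale finite_block_group =
  fixes S :: "'a set" and m :: "'a \<Rightarrow> 'a \<Rightarrow> 'a" (infixl \<open>\<cdot>\<close> 70)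
  assumes fin: "finite S" and bg: "block_group S m"
begin

section \<open>Idempotents and inverses in a finite block-group\<close>

lemma closed [simp, intro]: "x \<in> S \<Longrightarrow> y \<in> S \<Longrightarrow> x \<cdot> y \<in> S"
  using bg by (simp add: block_group_def semigroup_on_def)

lemma assoc: "x \<in> S \<Longrightarrow> y \<in> S \<Longrightarrow> z \<in> S \<Longrightarrow> x \<cdot> y \<cdot> z = x \<cdot> (y \<cdot> z)"
  using bg by (simp add: block_group_def semigroup_on_def)

text \<open>The two equations alone make \<open>e\<close> and \<open>f\<close> idempotent:
  \<open>e e = (e f) e = e (f e) = e f = e\<close>. So L-equivalent idempotents coincide;
  \<open>eq_if_R\<close> is the dual for R.\<close>

lemma eq_if_L:
  assumes "e \<in> S" "f \<in> S" "e \<cdot> f = e" "f \<cdot> e = f"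
  shows "e = f"
proof -
  have "e \<cdot> e = e" "f \<cdot> f = f" using assms assoc by metis+
  then show ?thesis using bg assms unfolding block_group_def by metis
qed

lemma eq_if_R:
  assumes "e \<in> S" "f \<in> S" "e \<cdot> f = f" "f \<cdot> e = e"
  shows "e = f"
proof -
  have "e \<cdot> e = e" "f \<cdot> f = f" using assms assoc by metis+
  then show ?thesis using bg assms unfolding block_group_def by metis
qed

lemma power_Suc_closed [simp, intro]: "x \<in> S \<Longrightarrow> power_Suc m x k \<in> S"
  by (induction k) auto

lemma power_Suc_add: "x \<in> S \<Longrightarrow> power_Suc m x i \<cdot> power_Suc m x j = power_Suc m x (Suc (i + j))"
  by (induction j) (simp_all flip: assoc)

lemma power_Suc_commutes: "x \<in> S \<Longrightarrow> x \<cdot> power_Suc m x k = power_Suc m x k \<cdot> x"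
  using power_Suc_add[of x 0 k] by simp

definition idem :: "'a \<Rightarrow> bool" where
  "idem x \<longleftrightarrow> x \<in> S \<and> x \<cdot> x = x"

lemma idem_power: "\<exists>K. \<forall>x\<in>S. idem (power_Suc m x K)"
proof -
  define N where "N = card S"
  \<comment> \<open>The factorial is a multiple of every possible period \<open>j - i\<close> and
    exceeds every preperiod, so one exponent serves all elements. Subtracting 1 accounts for the
    shift in \<open>power_Suc\<close>.\<close>
  define K where "K = fact (Suc N) - (1 :: nat)"
  have KN: "Suc K = fact (Suc N)" by (simp add: K_def)
  have "idem (power_Suc m x K)" if x: "x \<in> S" for x
  proof -
    have "\<not> inj_on (power_Suc m x) {..N}"
      using card_inj_on_le[of "power_Suc m x" "{..N}" S] fin x by (auto simp: N_def)
    then obtain i j where ij: "i < j" "j \<le> N" "power_Suc m x i = power_Suc m x j"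
      unfolding inj_on_def by (metis atMost_iff linorder_neqE_nat)
    have per: "power_Suc m x (t + (j - i)) = power_Suc m x t" if "i \<le> t" for t
      using that
    proof (induction rule: dec_induct)
      case base
      then show ?case using ij by simp
    next
      case (step t)
      then show ?case by simp
    qed
    have per2: "power_Suc m x (t + q * (j - i)) = power_Suc m x t" if "i \<le> t" for t q
    proof (induction q)
      case (Suc q)
      have "t + Suc q * (j - i) = t + q * (j - i) + (j - i)" by simp
      then show ?case using per[of "t + q * (j - i)"] that Suc by (simp only: trans_le_add1)
    qed simp
    have "(j - i) dvd fact (Suc N)" using ij by (intro dvd_fact) auto
    then obtain q where q: "Suc K = q * (j - i)" using KN by (metis dvd_def mult.commute)
    have "Suc N \<le> Suc K" using KN fact_ge_self[of "Suc N"] by simp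
    then have "i \<le> K" using ij by simp
    then have "power_Suc m x (K + Suc K) = power_Suc m x K" unfolding q by (rule per2)
    then have "power_Suc m x K \<cdot> power_Suc m x K = power_Suc m x K" using power_Suc_add[OF x] by simp
    then show ?thesis using x by (simp add: idem_def)
  qed
  then show ?thesis by blast
qed

definition inverses :: "'a \<Rightarrow> 'a \<Rightarrow> bool" where
  "inverses a b \<longleftrightarrow> a \<in> S \<and> b \<in> S \<and> a \<cdot> b \<cdot> a = a \<and> b \<cdot> a \<cdot> b = b"

lemma inverses_sym: "inverses a b \<Longrightarrow> inverses b a"
  by (simp add: inverses_def)

lemma inverses_idem: "inverses a b \<Longrightarrow> idem (a \<cdot> b)"
  unfolding inverses_def idem_def by (metis assoc closed)

text \<open>The idempotents \<open>a \<cdot> b\<close> and \<open>b \<cdot> a\<close> are R- and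
  L-equivalent to \<open>a\<close>, so both are equal to \<open>a\<close>.\<close>

lemma inverses_of_idem:
  assumes "inverses a b" "a \<cdot> a = a"
  shows "b = a"
proof -
  have S: "a \<in> S" "b \<in> S" and eq: "a \<cdot> b \<cdot> a = a" "b \<cdot> a \<cdot> b = b" using assms by (auto simp: inverses_def)
  have "a = a \<cdot> b" using S eq assms by - (rule eq_if_R, auto simp flip: assoc)
  moreover have "a = b \<cdot> a" using S eq assms by - (rule eq_if_L, auto simp: assoc)
  ultimately show ?thesis using eq by metis
qed

text \<open>Multiplication by \<open>d\<close> keeps \<open>f\<close> in its R-class. Then
  \<open>d \<cdot> y \<cdot> f\<close> is L-equivalent to \<open>f\<close>, hence equal to it, which
  gives \<open>d \<cdot> f = f\<close>; now \<open>f \<cdot> d\<close> is R-equivalent to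
  \<open>f\<close>.\<close>

lemma idem_below:
  assumes "idem f" "idem d" "y \<in> S" "f \<cdot> d \<cdot> y = f"
  shows "f \<cdot> d = f" "d \<cdot> f = f"
proof -
  have S: "f \<in> S" "d \<in> S" "f \<cdot> f = f" "d \<cdot> d = d" using assms by (auto simp: idem_def)
  define g where "g = d \<cdot> y \<cdot> f"
  have gS: "g \<in> S" using S assms by (simp add: g_def)
  have "f \<cdot> g = f" using S assms by (simp add: g_def flip: assoc)
  moreover have "g \<cdot> f = g" using S assms by (simp add: g_def assoc)
  ultimately have "f = g" using S gS by - (rule eq_if_L, auto)
  then have "d \<cdot> f = d \<cdot> (d \<cdot> y \<cdot> f)" by (simp add: g_def)
  also have "\<dots> = g" using S assms by (simp add: g_def flip: assoc)
  finally show df: "d \<cdot> f = f" using \<open>f = g\<close> by simp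
  have "f \<cdot> (f \<cdot> d) = f \<cdot> d" using S by (simp flip: assoc)
  moreover have "f \<cdot> d \<cdot> f = f" using S df by (simp add: assoc)
  ultimately show "f \<cdot> d = f" using S eq_if_R[of f "f \<cdot> d"] by simp
qed

text \<open>No identity is adjoined. If \<open>x\<close> has an inverse, this still is the principal
  two-sided ideal, since it then contains \<open>x\<close>.\<close>

definition ideal :: "'a \<Rightarrow> 'a set" where
  "ideal x = {p \<cdot> x \<cdot> q | p q. p \<in> S \<and> q \<in> S}"

lemma idealI: "p \<in> S \<Longrightarrow> q \<in> S \<Longrightarrow> y = p \<cdot> x \<cdot> q \<Longrightarrow> y \<in> ideal x"
  by (auto simp: ideal_def)

lemma ideal_subset: "x \<in> S \<Longrightarrow> ideal x \<subseteq> S"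
  by (auto simp: ideal_def)

lemma ideal_trans:
  assumes "x \<in> S" "y \<in> ideal x"
  shows "ideal y \<subseteq> ideal x"
proof
  fix z assume "z \<in> ideal y"
  then obtain p q where z: "p \<in> S" "q \<in> S" "z = p \<cdot> y \<cdot> q" by (auto simp: ideal_def)
  obtain p' q' where y: "p' \<in> S" "q' \<in> S" "y = p' \<cdot> x \<cdot> q'" using assms by (auto simp: ideal_def)
  have "z = (p \<cdot> p') \<cdot> x \<cdot> (q' \<cdot> q)" using z y assms by (simp add: assoc)
  then show "z \<in> ideal x" using z y by (intro idealI) auto
qed

lemma inverses_self:
  assumes "inverses a b"
  shows "a \<in> ideal a"
proof (rule idealI)
  show "a \<cdot> b \<in> S" "b \<cdot> a \<in> S" using assms by (auto simp: inverses_def)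
  show "a = a \<cdot> b \<cdot> a \<cdot> (b \<cdot> a)" using assms unfolding inverses_def by (metis assoc closed)
qed

text \<open>An instance of the stability of finite semigroups. Iterating
  \<open>g = p \<cdot> g \<cdot> w\<close> until the power of \<open>w\<close> is idempotent shows
  that this power fixes \<open>g\<close> from the right; as it begins with \<open>f\<close>, it
  follows that \<open>g = f \<cdot> z\<close> for some \<open>z\<close>.\<close>

lemma idem_top:
  assumes "idem f" "idem g" "f \<cdot> g = f" "g \<cdot> f = f" "g \<in> ideal f"
  shows "f = g"
proof -
  have S: "f \<in> S" "g \<in> S" "f \<cdot> f = f" "g \<cdot> g = g" using assms by (auto simp: idem_def)
  obtain p q where pq: "p \<in> S" "q \<in> S" "g = p \<cdot> f \<cdot> q" using assms by (auto simp: ideal_def)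
  define w where "w = f \<cdot> q"
  have w: "w \<in> S" using S pq by (simp add: w_def)
  have g: "g = p \<cdot> g \<cdot> w"
  proof -
    have "p \<cdot> g \<cdot> w = p \<cdot> (g \<cdot> f) \<cdot> q" using S pq by (simp add: w_def assoc)
    then show ?thesis using assms pq by simp
  qed
  have gk: "g = power_Suc m p k \<cdot> g \<cdot> power_Suc m w k" for k
  proof (induction k)
    case 0
    then show ?case using g by simp
  next
    case (Suc k)
    have "power_Suc m p k \<cdot> g \<cdot> power_Suc m w k = power_Suc m p k \<cdot> (p \<cdot> g \<cdot> w) \<cdot> power_Suc m w k" using g by simp
    also have "\<dots> = (power_Suc m p k \<cdot> p) \<cdot> g \<cdot> (w \<cdot> power_Suc m w k)" using S pq w by (simp add: assoc)
    finally show ?case using Suc power_Suc_commutes[OF w] by simp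
  qed
  obtain K where K: "\<forall>x\<in>S. idem (power_Suc m x K)" using idem_power by blast
  have "g \<cdot> power_Suc m w K = g"
    using gk[of K] K w S pq unfolding idem_def by (metis assoc closed power_Suc_closed)
  moreover have "\<exists>z\<in>S. power_Suc m w K = f \<cdot> z"
  proof (cases K)
    case 0
    then show ?thesis using pq by (auto simp: w_def)
  next
    case (Suc k)
    then have "power_Suc m w K = w \<cdot> power_Suc m w k" using w power_Suc_commutes by simp
    also have "\<dots> = f \<cdot> (q \<cdot> power_Suc m w k)" using S pq w by (simp add: w_def assoc)
    finally show ?thesis using pq w by blast
  qed
  ultimately obtain z where z: "z \<in> S" "g \<cdot> (f \<cdot> z) = g" by metis
  then have "g = f \<cdot> z" using assms S by (simp flip: assoc)
  then have "f \<cdot> g = g" using S z by (simp flip: assoc)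
  then show ?thesis using assms by simp
qed

section \<open>Walks of idempotents along a product\<close>

primrec state :: "'a \<Rightarrow> ('a \<times> 'a) list \<Rightarrow> 'a" where
  "state f [] = f"
| "state f (z # ds) = state (snd z \<cdot> f \<cdot> fst z) ds"

definition rprod :: "'a \<Rightarrow> ('a \<times> 'a) list \<Rightarrow> 'a" where
  "rprod x ds = foldl (\<lambda>x z. x \<cdot> fst z) x ds"

lemma rprod_simps [simp]: "rprod x [] = x" "rprod x (z # ds) = rprod (x \<cdot> fst z) ds" "rprod x (a @ b) = rprod (rprod x a) b"
  by (simp_all add: rprod_def)

definition all_inverses :: "('a \<times> 'a) list \<Rightarrow> bool" where
  "all_inverses ds \<longleftrightarrow> (\<forall>(d, d')\<in>set ds. inverses d d')"

text \<open>For factors in \<open>S\<close>, this means that the product stays in the R-class of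
  \<open>f\<close>.\<close>

definition returns :: "'a \<Rightarrow> ('a \<times> 'a) list \<Rightarrow> bool" where
  "returns f ds \<longleftrightarrow> (\<exists>y\<in>S. rprod f ds \<cdot> y = f)"

lemma all_inverses_simps [simp]: "all_inverses []" "all_inverses ((d, d') # ds) \<longleftrightarrow> inverses d d' \<and> all_inverses ds" "all_inverses (a @ b) \<longleftrightarrow> all_inverses a \<and> all_inverses b"
  by (auto simp: all_inverses_def)

lemma rprod_closed [simp]: "x \<in> S \<Longrightarrow> all_inverses ds \<Longrightarrow> rprod x ds \<in> S"
  by (induction ds arbitrary: x) (auto simp: inverses_def)

lemma rprod_factor: "all_inverses ds \<Longrightarrow> y \<in> S \<Longrightarrow> \<exists>w\<in>S. \<forall>x\<in>S. rprod x ds \<cdot> y = x \<cdot> w"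
proof (induction ds)
  case (Cons z ds)
  obtain d d' where z: "z = (d, d')" by fastforce
  obtain w where w: "w \<in> S" "\<forall>x\<in>S. rprod x ds \<cdot> y = x \<cdot> w" using Cons z by auto
  have "d \<in> S" using Cons z by (auto simp: inverses_def)
  then show ?case using w z by (intro bexI[of _ "d \<cdot> w"]) (auto simp: assoc)
qed auto

lemma rprod_mult: "all_inverses ds \<Longrightarrow> x \<in> S \<Longrightarrow> y \<in> S \<Longrightarrow> rprod (x \<cdot> y) ds = x \<cdot> rprod y ds"
  by (induction ds arbitrary: y) (auto simp: inverses_def assoc)

text \<open>
  In the groupoid of a regular J-class, \<open>d\<close> is an arrow from the idempotent \<open>d \<cdot> d'\<close> to \<open>d' \<cdot> d\<close>. If a
  product that starts at the idempotent \<open>f\<close> stays in the J-class, then its next factor \<open>d\<close> either is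
  such an arrow with source \<open>f\<close> or is an idempotent above \<open>f\<close>, and in both cases the walk continues
  at \<open>d' \<cdot> f \<cdot> d\<close>.
\<close>

lemma state_step:
  assumes f: "idem f" and d: "inverses d d'" and returns: "returns f ((d, d') # ds)" and ds: "all_inverses ds"
    and e: "e \<in> S" "e \<in> ideal f" and cl: "d \<cdot> d = d \<or> d \<in> ideal e"
  shows "idem (d' \<cdot> f \<cdot> d)" "returns (d' \<cdot> f \<cdot> d) ds" "e \<in> ideal (d' \<cdot> f \<cdot> d)"
    "d \<cdot> d' \<cdot> f = f"
    "d \<cdot> d = d \<Longrightarrow> d' = d \<and> d' \<cdot> f \<cdot> d = f \<and> f \<cdot> d = f"
    "d \<cdot> d \<noteq> d \<Longrightarrow> f = d \<cdot> d' \<and> d' \<cdot> f \<cdot> d = d' \<cdot> d"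
proof -
  have S: "f \<in> S" "d \<in> S" "d' \<in> S" "f \<cdot> f = f" "d \<cdot> d' \<cdot> d = d" "d' \<cdot> d \<cdot> d' = d'"
    using f d by (auto simp: idem_def inverses_def)
  obtain y where y: "y \<in> S" "rprod (f \<cdot> d) ds \<cdot> y = f" using returns by (auto simp: returns_def)
  obtain w where w: "w \<in> S" "\<forall>x\<in>S. rprod x ds \<cdot> y = x \<cdot> w" using rprod_factor[OF ds y(1)] by blast
  have fdw: "f \<cdot> d \<cdot> w = f" using y w S by auto
  have g: "idem (d \<cdot> d')" using inverses_idem[OF d] .
  have "f \<cdot> (d \<cdot> d') \<cdot> (d \<cdot> w) = f \<cdot> (d \<cdot> d' \<cdot> d) \<cdot> w" using S(1-3) w(1) by (simp add: assoc)
  then have "f \<cdot> (d \<cdot> d') \<cdot> (d \<cdot> w) = f" using S fdw by simp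
  then have fg: "f \<cdot> (d \<cdot> d') = f" and gf: "d \<cdot> d' \<cdot> f = f"
    using idem_below[OF f g, of "d \<cdot> w"] S w by auto
  show "d \<cdot> d' \<cdot> f = f" by (rule gf)
  have "d' \<cdot> f \<cdot> d \<cdot> (d' \<cdot> f \<cdot> d) = d' \<cdot> (f \<cdot> (d \<cdot> d')) \<cdot> f \<cdot> d" using S(1-3) by (simp add: assoc)
  then have "d' \<cdot> f \<cdot> d \<cdot> (d' \<cdot> f \<cdot> d) = d' \<cdot> (f \<cdot> f) \<cdot> d" using S(1-3) fg by (simp add: assoc)
  then show "idem (d' \<cdot> f \<cdot> d)" using S by (simp add: idem_def)
  have "rprod (d' \<cdot> f \<cdot> d) ds \<cdot> (y \<cdot> (f \<cdot> d)) = d' \<cdot> (rprod (f \<cdot> d) ds \<cdot> y) \<cdot> f \<cdot> d"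
    using S(1-3) ds y(1) rprod_mult[OF ds, of d' "f \<cdot> d"] by (simp add: assoc)
  also have "\<dots> = d' \<cdot> f \<cdot> d" using S(1-4) by (simp add: y(2)) (simp add: assoc flip: assoc[of f f])
  finally show "returns (d' \<cdot> f \<cdot> d) ds" unfolding returns_def using S y by blast
  have "f = d \<cdot> d' \<cdot> f \<cdot> (d \<cdot> d')" using fg gf by simp
  then have "f = d \<cdot> (d' \<cdot> f \<cdot> d) \<cdot> d'" using S(1-3) by (simp add: assoc)
  then have "f \<in> ideal (d' \<cdot> f \<cdot> d)" using S by (intro idealI) auto
  then show "e \<in> ideal (d' \<cdot> f \<cdot> d)" using ideal_trans[of "d' \<cdot> f \<cdot> d" f] S e by auto
  show "d' = d \<and> d' \<cdot> f \<cdot> d = f \<and> f \<cdot> d = f" if "d \<cdot> d = d"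
  proof -
    have "d' = d" using inverses_of_idem[OF d that] .
    moreover have "f \<cdot> d = f" "d \<cdot> f = f" using fg gf \<open>d' = d\<close> that by auto
    ultimately show ?thesis using S by (simp add: assoc)
  qed
  show "f = d \<cdot> d' \<and> d' \<cdot> f \<cdot> d = d' \<cdot> d" if "d \<cdot> d \<noteq> d"
  proof -
    have "d \<in> ideal e" using cl that by blast
    then obtain p q where pq: "p \<in> S" "q \<in> S" "d = p \<cdot> e \<cdot> q" by (auto simp: ideal_def)
    then have "d \<cdot> d' = p \<cdot> e \<cdot> (q \<cdot> d')" using S(1-3) e(1) by (metis assoc closed)
    then have "d \<cdot> d' \<in> ideal e" using pq S by (intro idealI) auto
    then have "d \<cdot> d' \<in> ideal f" using ideal_trans[of f e] S e by auto
    then have "f = d \<cdot> d'" using idem_top[OF f g fg gf] by simp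
    then show ?thesis using S by (simp add: assoc)
  qed
qed

text \<open>Factors outside the ideal of \<open>e\<close> are tolerated only if they are idempotent.
  For the remaining ones \<open>idem_top\<close> identifies the source of the arrow with the current
  state.\<close>

definition idem_or_in_ideal :: "'a \<Rightarrow> ('a \<times> 'a) list \<Rightarrow> bool" where
  "idem_or_in_ideal e ds \<longleftrightarrow> (\<forall>(d, d')\<in>set ds. d \<cdot> d = d \<or> d \<in> ideal e)"

lemma idem_or_in_ideal_simps [simp]: "idem_or_in_ideal e []" "idem_or_in_ideal e ((d, d') # ds) \<longleftrightarrow> (d \<cdot> d = d \<or> d \<in> ideal e) \<and> idem_or_in_ideal e ds"
  "idem_or_in_ideal e (a @ b) \<longleftrightarrow> idem_or_in_ideal e a \<and> idem_or_in_ideal e b"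
  by (auto simp: idem_or_in_ideal_def)

lemma returns_append: "returns f (a @ b) \<Longrightarrow> all_inverses a \<Longrightarrow> all_inverses b \<Longrightarrow> f \<in> S \<Longrightarrow> returns f a"
  unfolding returns_def using rprod_factor[of b] by (metis rprod_closed rprod_simps(3))

text \<open>The invariant is that \<open>x\<close>, the product read so far, is L-equivalent to the
  current state \<open>f\<close>; this is what the equations for \<open>x\<close> and
  \<open>z\<close> express.\<close>

lemma walk:
  assumes "idem f" "all_inverses ds" "returns f (ds @ b)" "all_inverses b" "e \<in> S" "e \<in> ideal f" "idem_or_in_ideal e ds"
    and "x \<in> S" "z \<in> S" "x \<cdot> f = x" "f = z \<cdot> x"
  shows "idem (state f ds) \<and> returns (state f ds) b \<and> e \<in> ideal (state f ds) \<and> rprod x ds \<cdot> state f ds = rprod x ds \<and>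
    (\<exists>z\<in>S. state f ds = z \<cdot> rprod x ds)"
  using assms
proof (induction ds arbitrary: f x z)
  case Nil
  then show ?case by auto
next
  case (Cons a ds)
  obtain d d' where a: "a = (d, d')" by fastforce
  have d: "inverses d d'" and ds: "all_inverses ds" "idem_or_in_ideal e ds" "all_inverses (ds @ b)" and cl: "d \<cdot> d = d \<or> d \<in> ideal e"
    using Cons.prems a by auto
  have "returns f ((d, d') # (ds @ b))" using Cons.prems a by simp
  note ar = state_step[OF Cons.prems(1) d this ds(3) Cons.prems(5,6) cl]
  have S: "d \<in> S" "d' \<in> S" "f \<in> S" using d Cons.prems by (auto simp: inverses_def idem_def)
  have "x \<cdot> d \<cdot> (d' \<cdot> f \<cdot> d) = x \<cdot> (d \<cdot> d' \<cdot> f) \<cdot> d" using S Cons.prems by (simp add: assoc)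
  then have "x \<cdot> d \<cdot> (d' \<cdot> f \<cdot> d) = x \<cdot> d" using ar(4) Cons.prems by simp
  moreover have "d' \<cdot> f \<cdot> d = (d' \<cdot> z) \<cdot> (x \<cdot> d)" using S Cons.prems(8,9,11) by (simp add: assoc)
  ultimately show ?case
    using Cons.IH[OF ar(1) ds(1) ar(2) Cons.prems(4,5) ar(3) ds(2), of "x \<cdot> d" "d' \<cdot> z"] S Cons.prems(8,9) a
    by simp
qed

lemma swap_ideal:
  assumes "inverses c c'" "e \<in> S" "c \<in> ideal e"
  shows "c' \<in> ideal e"
proof -
  have S: "c \<in> S" "c' \<in> S" "c' \<cdot> c \<cdot> c' = c'" using assms by (auto simp: inverses_def)
  then have "c' \<in> ideal c" by (intro idealI[of c' c']) auto
  then show ?thesis using ideal_trans[OF assms(2,3)] by blast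
qed

lemma all_inverses_swap: "all_inverses cs \<Longrightarrow> all_inverses (map prod.swap cs)"
  by (auto simp: all_inverses_def inverses_sym)

lemma idem_or_in_ideal_swap:
  assumes "all_inverses cs" "idem_or_in_ideal e cs" "e \<in> S"
  shows "idem_or_in_ideal e (map prod.swap cs)"
  unfolding idem_or_in_ideal_def
proof clarsimp
  fix c c' assume "(c, c') \<in> set cs" and c': "c' \<notin> ideal e"
  then have c: "inverses c c'" "c \<cdot> c = c \<or> c \<in> ideal e" using assms by (auto simp: all_inverses_def idem_or_in_ideal_def)
  then have "c \<cdot> c = c" using swap_ideal[OF c(1) assms(3)] c' by blast
  then show "c' \<cdot> c' = c'" using inverses_of_idem[OF c(1)] by simp
qed

text \<open>
  Reading \<open>c\<close> at \<open>f\<close> and \<open>c'\<close> at \<open>g\<close> either keeps the pair of states \<open>(f, g)\<close> or swaps it.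
\<close>

lemma two_walks:
  assumes "idem f" "idem g" "all_inverses cs" "returns f cs" "returns g (map prod.swap cs)" "e \<in> S" "e \<in> ideal f" "e \<in> ideal g" "idem_or_in_ideal e cs"
  shows "state f cs = f \<and> state g (map prod.swap cs) = g \<or> state f cs = g \<and> state g (map prod.swap cs) = f"
  using assms
proof (induction cs arbitrary: f g)
  case Nil
  then show ?case by simp
next
  case (Cons a cs)
  obtain c c' where a: "a = (c, c')" by fastforce
  have c: "inverses c c'" "inverses c' c" and cs: "all_inverses cs" "idem_or_in_ideal e cs" "all_inverses (map prod.swap cs)" and cl: "c \<cdot> c = c \<or> c \<in> ideal e"
    using Cons.prems a inverses_sym all_inverses_swap by auto
  have cl': "c' \<cdot> c' = c' \<or> c' \<in> ideal e"
    using cl swap_ideal[OF c(1) Cons.prems(6)] inverses_of_idem[OF c(1)] by metis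
  note ar = state_step[OF Cons.prems(1) c(1) _ cs(1) Cons.prems(6,7) cl]
  note ar' = state_step[OF Cons.prems(2) c(2) _ cs(3) Cons.prems(6,8) cl']
  have returns: "returns f ((c, c') # cs)" "returns g ((c', c) # map prod.swap cs)" using Cons.prems a by auto
  have IH: "state (c' \<cdot> f \<cdot> c) cs = c' \<cdot> f \<cdot> c \<and> state (c \<cdot> g \<cdot> c') (map prod.swap cs) = c \<cdot> g \<cdot> c' \<or>
      state (c' \<cdot> f \<cdot> c) cs = c \<cdot> g \<cdot> c' \<and> state (c \<cdot> g \<cdot> c') (map prod.swap cs) = c' \<cdot> f \<cdot> c"
    using Cons.IH[OF ar(1) ar'(1) cs(1) ar(2) ar'(2) Cons.prems(6) ar(3) ar'(3) cs(2)] returns by blast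
  show ?case
  proof (cases "c \<cdot> c = c")
    case True
    then have "c' \<cdot> c' = c'" using inverses_of_idem[OF c(1) True] by simp
    then have "c' \<cdot> f \<cdot> c = f" "c \<cdot> g \<cdot> c' = g"
      using ar(5)[OF returns(1) True] ar'(5)[OF returns(2)] by blast+
    then show ?thesis using IH unfolding a by simp
  next
    case False
    then have "c' \<cdot> c' \<noteq> c'" using inverses_of_idem[OF c(2)] by metis
    then have "c' \<cdot> f \<cdot> c = g" "c \<cdot> g \<cdot> c' = f"
      using ar(6)[OF returns(1) False] ar'(6)[OF returns(2)] by metis+
    then show ?thesis using IH unfolding a by (simp only: state.simps list.map swap_simp fst_conv snd_conv) blast
  qed
qed

end

section \<open>Maximal subgroups and the descent through the levels\<close>

context finite_block_group
begin

section \<open>Maximal subgroups, as groups of units of local monoids\<close>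

definition max_subgroup :: "'a \<Rightarrow> 'a set" where
  "max_subgroup e = {x \<in> S. e \<cdot> x = x \<and> x \<cdot> e = x \<and> (\<exists>y\<in>S. e \<cdot> y = y \<and> y \<cdot> e = y \<and> x \<cdot> y = e \<and> y \<cdot> x = e)}"

definition max_group :: "'a \<Rightarrow> 'a monoid" where
  "max_group e = \<lparr>carrier = max_subgroup e, mult = (\<cdot>), one = e\<rparr>"

lemma max_group_simps [simp]: "carrier (max_group e) = max_subgroup e" "mult (max_group e) = (\<cdot>)" "one (max_group e) = e"
  by (simp_all add: max_group_def)

lemma max_subgroup_in_S: "x \<in> max_subgroup e \<Longrightarrow> x \<in> S"
  by (simp add: max_subgroup_def)

lemma max_subgroupI: "x \<in> S \<Longrightarrow> y \<in> S \<Longrightarrow> e \<cdot> x = x \<Longrightarrow> x \<cdot> e = x \<Longrightarrow> e \<cdot> y = y \<Longrightarrow> y \<cdot> e = y \<Longrightarrow> x \<cdot> y = e \<Longrightarrow> y \<cdot> x = e \<Longrightarrow> x \<in> max_subgroup e"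
  by (auto simp: max_subgroup_def)

lemma group_max_group:
  assumes "idem e"
  shows "group (max_group e)"
proof (rule groupI; simp)
  have e: "e \<in> S" "e \<cdot> e = e" using assms by (auto simp: idem_def)
  show "e \<in> max_subgroup e" using e by (intro max_subgroupI[of e e]) auto
  show "\<exists>y\<in>max_subgroup e. y \<cdot> x = e" if x: "x \<in> max_subgroup e" for x
  proof -
    obtain y where "y \<in> S" "e \<cdot> y = y" "y \<cdot> e = y" "x \<cdot> y = e" "y \<cdot> x = e" "x \<in> S" "e \<cdot> x = x" "x \<cdot> e = x"
      using x by (auto simp: max_subgroup_def)
    then show ?thesis by (intro bexI[of _ y] max_subgroupI[of y x]) auto
  qed
  show "x \<cdot> y \<in> max_subgroup e" if xy: "x \<in> max_subgroup e" "y \<in> max_subgroup e" for x y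
  proof -
    obtain x' where x: "x \<in> S" "x' \<in> S" "e \<cdot> x' = x'" "x' \<cdot> e = x'" "x \<cdot> x' = e" "x' \<cdot> x = e" "e \<cdot> x = x" "x \<cdot> e = x"
      using xy(1) by (auto simp: max_subgroup_def)
    obtain y' where y: "y \<in> S" "y' \<in> S" "e \<cdot> y' = y'" "y' \<cdot> e = y'" "y \<cdot> y' = e" "y' \<cdot> y = e" "e \<cdot> y = y" "y \<cdot> e = y"
      using xy(2) by (auto simp: max_subgroup_def)
    show ?thesis
    proof (rule max_subgroupI[of _ "y' \<cdot> x'"])
      show "x \<cdot> y \<cdot> (y' \<cdot> x') = e" using x y e by (metis assoc closed)
      show "y' \<cdot> x' \<cdot> (x \<cdot> y) = e" using x y e by (metis assoc closed)
      show "e \<cdot> (x \<cdot> y) = x \<cdot> y" "x \<cdot> y \<cdot> e = x \<cdot> y" "e \<cdot> (y' \<cdot> x') = y' \<cdot> x'" "y' \<cdot> x' \<cdot> e = y' \<cdot> x'"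
        using x y e by (metis assoc)+
    qed (use x y in auto)
  qed
  show "x \<cdot> y \<cdot> z = x \<cdot> (y \<cdot> z)" if "x \<in> max_subgroup e" "y \<in> max_subgroup e" "z \<in> max_subgroup e" for x y z
    using that by (simp add: assoc max_subgroup_in_S)
  show "e \<cdot> x = x" if "x \<in> max_subgroup e" for x using that by (simp add: max_subgroup_def)
qed

lemma inv_max_group:
  assumes "idem e" "x \<in> max_subgroup e" "y \<in> max_subgroup e" "y \<cdot> x = e"
  shows "m_inv (max_group e) x = y"
  using group.inv_equality[OF group_max_group[OF assms(1)], of y x] assms by simp

lemma max_subgroup_of_inverses:
  assumes "inverses c c'" "c \<cdot> c' = c' \<cdot> c"
  shows "c \<in> max_subgroup (c \<cdot> c')"
  using assms unfolding inverses_def by (intro max_subgroupI[of c c']) (auto, (metis assoc closed)+)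

lemma idem_in_ideal: "idem e \<Longrightarrow> e \<in> ideal e"
  by (intro idealI[of e e]) (auto simp: idem_def)

text \<open>In the groupoid picture a factor that commutes with its inverse is a loop, so the walk
  never leaves \<open>e\<close>.\<close>

lemma stationary:
  assumes "idem e" "returns e ds" "all_inverses ds" "idem_or_in_ideal e ds" "\<forall>(d, d')\<in>set ds. d \<cdot> d = d \<or> d \<cdot> d' = d' \<cdot> d"
  shows "\<forall>(d, d')\<in>set ds. d \<cdot> d = d \<and> d' = d \<and> e \<cdot> d = e \<or> e = d \<cdot> d' \<and> e = d' \<cdot> d"
  using assms(2-5)
proof (induction ds)
  case (Cons a ds)
  obtain d d' where a: "a = (d, d')" by fastforce
  have d: "inverses d d'" "all_inverses ds" "d \<cdot> d = d \<or> d \<in> ideal e" "returns e ((d, d') # ds)" "idem_or_in_ideal e ds"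
    and com: "d \<cdot> d = d \<or> d \<cdot> d' = d' \<cdot> d"
    using Cons.prems a by auto
  have e: "e \<in> S" using assms(1) by (simp add: idem_def)
  note ar = state_step[OF assms(1) d(1,4,2) e idem_in_ideal[OF assms(1)] d(3)]
  have *: "d' \<cdot> e \<cdot> d = e \<and> (d \<cdot> d = d \<and> d' = d \<and> e \<cdot> d = e \<or> e = d \<cdot> d' \<and> e = d' \<cdot> d)"
  proof (cases "d \<cdot> d = d")
    case True
    then show ?thesis using ar(5) by blast
  next
    case False
    then show ?thesis using ar(6) com by metis
  qed
  then have "returns e ds" using ar(2) by simp
  then show ?case using Cons.IH d * Cons.prems(4) a by simp
qed simp

lemma state_append: "state f (a @ b) = state (state f a) b"
  by (induction a arbitrary: f) auto

text \<open>One level of the words in abstract form: \<open>r\<close> is the value of a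
  \<open>bar\<close> term, \<open>cs\<close> lists the values of the blocks with their inverses, and
  \<open>r \<cdot> r'\<close> is the idempotent power in front.\<close>

definition node :: "'a \<Rightarrow> 'a \<Rightarrow> ('a \<times> 'a) list \<Rightarrow> bool" where
  "node r r' cs \<longleftrightarrow> inverses r r' \<and> all_inverses cs \<and> r = rprod (r \<cdot> r') (cs @ map prod.swap cs)"

lemma node_returns:
  assumes "node r r' cs"
  shows "returns (r \<cdot> r') (cs @ map prod.swap cs)"
  using assms unfolding returns_def node_def inverses_def by metis

lemma ideal_child:
  assumes "node r r' cs" "(c, c') \<in> set cs"
  shows "ideal r \<subseteq> ideal c"
proof -
  have r: "inverses r r'" "all_inverses cs" "r = rprod (r \<cdot> r') (cs @ map prod.swap cs)" using assms by (auto simp: node_def)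
  have S: "r \<in> S" "r' \<in> S" "r \<cdot> r' \<cdot> r = r" using r by (auto simp: inverses_def)
  obtain a b where ab: "cs = a @ (c, c') # b" using assms(2) by (meson split_list)
  have i: "all_inverses a" "all_inverses b" "inverses c c'" "all_inverses (b @ map prod.swap cs)" using r(2) all_inverses_swap[OF r(2)] ab by auto
  obtain w where w: "w \<in> S" "\<forall>x\<in>S. rprod x (b @ map prod.swap cs) \<cdot> (r' \<cdot> r) = x \<cdot> w"
    using rprod_factor[OF i(4), of "r' \<cdot> r"] S by auto
  have c: "c \<in> S" using i by (simp add: inverses_def)
  have p: "rprod (r \<cdot> r') a \<in> S" using S i by simp
  have "cs @ map prod.swap cs = a @ (c, c') # (b @ map prod.swap cs)" using ab by simp
  then have "r = rprod (rprod (r \<cdot> r') a \<cdot> c) (b @ map prod.swap cs)" using r(3) by simp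
  then have "r \<cdot> (r' \<cdot> r) = rprod (r \<cdot> r') a \<cdot> c \<cdot> w" using w p c by (metis closed)
  then have "r = rprod (r \<cdot> r') a \<cdot> c \<cdot> w" using S by (simp flip: assoc)
  then have "r \<in> ideal c" using p w by (intro idealI)
  then show ?thesis using ideal_trans c by blast
qed

text \<open>Reading \<open>cs\<close> leads from \<open>e\<close> to some \<open>g\<close>. By
  \<open>two_walks\<close>, reading the inverses in the same order then leads from \<open>g\<close>
  back to \<open>e\<close>: either the pair is swapped, or it is kept and \<open>g = e\<close>. So
  \<open>r\<close> is both R- and L-equivalent to \<open>e\<close>.\<close>

lemma node_group:
  assumes "node r r' cs" "idem_or_in_ideal (r \<cdot> r') cs"
  shows "r \<cdot> r' = r' \<cdot> r"
proof -
  define e where "e = r \<cdot> r'"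
  have r: "inverses r r'" "all_inverses cs" "r = rprod e (cs @ map prod.swap cs)" using assms by (auto simp: node_def e_def)
  have S: "r \<in> S" "r' \<in> S" "r \<cdot> r' \<cdot> r = r" "r' \<cdot> r \<cdot> r' = r'" using r by (auto simp: inverses_def)
  have e: "idem e" "e \<in> S" "e \<cdot> e = e" using inverses_idem[OF r(1)] by (auto simp: e_def idem_def)
  have returns: "returns e (cs @ map prod.swap cs)" using node_returns[OF assms(1)] by (simp add: e_def)
  have sw: "all_inverses (map prod.swap cs)" "idem_or_in_ideal e (map prod.swap cs)"
    using all_inverses_swap[OF r(2)] idem_or_in_ideal_swap[OF r(2)] assms(2) e by (auto simp: e_def)
  have cl: "idem_or_in_ideal e cs" using assms by (simp add: e_def)
  define g where "g = state e cs"
  have g: "idem g" "returns g (map prod.swap cs)" "e \<in> ideal g"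
    using walk[OF e(1) r(2) returns sw(1) e(2) idem_in_ideal[OF e(1)] cl, of e e] e by (auto simp: g_def)
  have okc: "returns e cs" using returns_append[OF returns r(2) sw(1) e(2)] .
  have "state g (map prod.swap cs) = e"
    using two_walks[OF e(1) g(1) r(2) okc g(2) e(2) idem_in_ideal[OF e(1)] g(3) cl] by (auto simp: g_def)
  then have fin: "state e (cs @ map prod.swap cs) = e" by (simp add: state_append g_def)
  have w: "r \<cdot> e = r \<and> (\<exists>z\<in>S. e = z \<cdot> r)"
  proof -
    have "all_inverses (cs @ map prod.swap cs)" "idem_or_in_ideal e (cs @ map prod.swap cs)" using r sw cl by auto
    from walk[OF e(1) this(1) _ _ e(2) idem_in_ideal[OF e(1)] this(2), of "[]" e e] returns e fin r(3)
    show ?thesis by auto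
  qed
  then obtain z where z: "z \<in> S" "e = z \<cdot> r" by blast
  have "e \<cdot> (r' \<cdot> r) = z \<cdot> (r \<cdot> r' \<cdot> r)" using z S(1,2) by (simp add: assoc)
  then have 1: "e \<cdot> (r' \<cdot> r) = e" using S(3) z by simp
  have 2: "r' \<cdot> r \<cdot> e = r' \<cdot> r" using w S(1,2) e(2) by (simp add: assoc)
  show ?thesis using eq_if_L[of e "r' \<cdot> r"] 1 2 S e by (simp flip: e_def)
qed

lemma rprod_const: "\<forall>(c, c')\<in>set ds. e \<cdot> c = e \<Longrightarrow> rprod e ds = e"
  by (induction ds) auto

text \<open>All factors are idempotents above \<open>e\<close>, which absorbs them one by one, so
  that the product is \<open>e\<close> itself.\<close>

lemma node_idem:
  assumes "node r r' cs" "\<forall>(c, c')\<in>set cs. c \<cdot> c = c"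
  shows "r \<cdot> r = r"
proof -
  define e where "e = r \<cdot> r'"
  have r: "inverses r r'" "all_inverses cs" "r = rprod e (cs @ map prod.swap cs)" using assms by (auto simp: node_def e_def)
  have e: "idem e" using inverses_idem[OF r(1)] by (simp add: e_def)
  have returns: "returns e (cs @ map prod.swap cs)" using node_returns[OF assms(1)] by (simp add: e_def)
  have ic: "c \<cdot> c = c \<and> c' = c" if "(c, c') \<in> set cs" for c c'
    using that r(2) assms(2) inverses_of_idem unfolding all_inverses_def by blast
  define ds where "ds = cs @ map prod.swap cs"
  have all: "d \<cdot> d = d \<and> d' = d" if "(d, d') \<in> set ds" for d d'
    using that ic[of d d'] ic[of d' d] by (auto simp: ds_def)
  have "\<forall>(d, d')\<in>set ds. d \<cdot> d = d \<and> d' = d \<and> e \<cdot> d = e \<or> e = d \<cdot> d' \<and> e = d' \<cdot> d"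
  proof (rule stationary[OF e returns[folded ds_def]])
    show "all_inverses ds" using r all_inverses_swap[OF r(2)] by (simp add: ds_def)
    show "idem_or_in_ideal e ds" "\<forall>(d, d')\<in>set ds. d \<cdot> d = d \<or> d \<cdot> d' = d' \<cdot> d"
      using all unfolding idem_or_in_ideal_def by blast+
  qed
  then have "e \<cdot> d = e" if "(d, d') \<in> set ds" for d d'
    using all[OF that] that by fastforce
  then have "\<forall>(d, d')\<in>set ds. e \<cdot> d = e" by blast
  then have "r = e" using r(3) rprod_const by (simp add: ds_def)
  then show ?thesis using e by (simp add: idem_def)
qed

text \<open>With \<open>k'\<close> inverse to \<open>k\<close> one has
  \<open>k A k' B = (k A k' A') (A B)\<close>, where \<open>A'\<close> is the inverse of
  \<open>A\<close>; the first bracket is a commutator and the second is covered by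
  induction.\<close>

lemma rprod_derived:
  assumes e: "idem e" and K: "subgroup K (max_group e)" and cs: "all_inverses cs"
    and cK: "\<forall>(c, c')\<in>set cs. e \<cdot> c \<in> K \<and> e \<cdot> c' = m_inv (max_group e) (e \<cdot> c)"
  shows "rprod e cs \<in> K \<and> rprod e (map prod.swap cs) \<in> K \<and> rprod e cs \<cdot> rprod e (map prod.swap cs) \<in> derived (max_group e) K"
  using cs cK
proof (induction cs)
  interpret G: group "max_group e" using group_max_group[OF e] .
  have KH: "K \<subseteq> max_subgroup e" using subgroup.subset[OF K] by simp
  have D: "subgroup (derived (max_group e) K) (max_group e)" using G.derived_is_subgroup KH by simp
  have eS: "e \<in> S" "e \<cdot> e = e" using e by (auto simp: idem_def)
  {
    case Nil
    then show ?case using subgroup.one_closed[OF K] subgroup.one_closed[OF D] eS by simp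
  next
    case (Cons a cs)
    obtain c c' where a: "a = (c, c')" by fastforce
    define k k' A B where "k = e \<cdot> c" and "k' = e \<cdot> c'" and "A = rprod e cs" and "B = rprod e (map prod.swap cs)"
    have ic: "inverses c c'" "all_inverses cs" "all_inverses (map prod.swap cs)" using Cons.prems a all_inverses_swap by auto
    have kK: "k \<in> K" "k' = m_inv (max_group e) k" using Cons.prems a by (auto simp: k_def k'_def)
    then have k'K: "k' \<in> K" using subgroup.m_inv_closed[OF K] by simp
    have AB: "A \<in> K" "B \<in> K" "A \<cdot> B \<in> derived (max_group e) K"
      using Cons.IH Cons.prems ic by (auto simp: A_def B_def)
    define A' where "A' = m_inv (max_group e) A"
    have A'K: "A' \<in> K" using subgroup.m_inv_closed[OF K] AB by (simp add: A'_def)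
    have inH: "k \<in> max_subgroup e" "k' \<in> max_subgroup e" "A \<in> max_subgroup e" "B \<in> max_subgroup e" "A' \<in> max_subgroup e" using kK k'K AB A'K KH by auto
    then have inS: "k \<in> S" "k' \<in> S" "A \<in> S" "B \<in> S" "A' \<in> S" using max_subgroup_in_S by auto
    have re: "k \<cdot> e = k" "k' \<cdot> e = k'" "e \<cdot> B = B" using inH by (auto simp: max_subgroup_def)
    have pA: "rprod e (a # cs) = k \<cdot> A"
    proof -
      have "rprod e (a # cs) = rprod (k \<cdot> e) cs" using re a by (simp add: k_def)
      then show ?thesis using rprod_mult[OF ic(2) inS(1) eS(1)] by (simp add: A_def)
    qed
    have pB: "rprod e (map prod.swap (a # cs)) = k' \<cdot> B"
    proof -
      have "rprod e (map prod.swap (a # cs)) = rprod (k' \<cdot> e) (map prod.swap cs)" using re a by (simp add: k'_def)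
      then show ?thesis using rprod_mult[OF ic(3) inS(2) eS(1)] by (simp add: B_def)
    qed
    have "k \<cdot> A \<cdot> k' \<cdot> A' \<in> derived_set (max_group e) K"
      using kK AB A'_def by auto
    then have 1: "k \<cdot> A \<cdot> k' \<cdot> A' \<in> derived (max_group e) K" unfolding derived_def by (rule generate.incl)
    have A'A: "A' \<cdot> A = e" using G.l_inv[of A] inH by (simp add: A'_def)
    have "k \<cdot> A \<cdot> (k' \<cdot> B) = k \<cdot> A \<cdot> (k' \<cdot> (e \<cdot> B))" using re by simp
    also have "\<dots> = k \<cdot> A \<cdot> k' \<cdot> A' \<cdot> (A \<cdot> B)" unfolding A'A[symmetric] using inS by (simp add: assoc)
    also have "\<dots> \<in> derived (max_group e) K" using subgroup.m_closed[OF D 1 AB(3)] by simp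
    finally have "k \<cdot> A \<cdot> (k' \<cdot> B) \<in> derived (max_group e) K" .
    then show ?case unfolding pA pB
      using subgroup.m_closed[OF K kK(1) AB(1)] subgroup.m_closed[OF K k'K AB(2)] by simp
  }
qed

text \<open>By \<open>stationary\<close>, the non-idempotent factors all lie in the maximal subgroup
  of \<open>e\<close>, and the idempotent ones act as its identity.\<close>

lemma node_derived:
  assumes nd: "node r r' cs" and cl: "idem_or_in_ideal (r \<cdot> r') cs"
    and cs: "\<forall>(c, c')\<in>set cs. c \<cdot> c \<noteq> c \<longrightarrow> c \<cdot> c' = c' \<cdot> c \<and> c \<in> (derived (max_group (c \<cdot> c')) ^^ j) (max_subgroup (c \<cdot> c'))"
  shows "r \<in> (derived (max_group (r \<cdot> r')) ^^ Suc j) (max_subgroup (r \<cdot> r'))"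
proof -
  define e where "e = r \<cdot> r'"
  have r: "inverses r r'" "all_inverses cs" "r = rprod e (cs @ map prod.swap cs)" using nd by (auto simp: node_def e_def)
  have e: "idem e" using inverses_idem[OF r(1)] by (simp add: e_def)
  have eS: "e \<in> S" "e \<cdot> e = e" using e by (auto simp: idem_def)
  interpret G: group "max_group e" using group_max_group[OF e] .
  define K where "K = (derived (max_group e) ^^ j) (max_subgroup e)"
  have K: "subgroup K (max_group e)" using G.exp_of_derived_is_subgroup[OF G.subgroup_self] by (simp add: K_def)
  have returns: "returns e cs" using returns_append[OF node_returns[OF nd] r(2) all_inverses_swap[OF r(2)]] eS by (simp add: e_def)
  have state: "\<forall>(d, d')\<in>set cs. d \<cdot> d = d \<and> d' = d \<and> e \<cdot> d = e \<or> e = d \<cdot> d' \<and> e = d' \<cdot> d"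
    using cl cs by (intro stationary[OF e returns r(2)]) (auto simp: e_def)
  have "e \<cdot> c \<in> K \<and> e \<cdot> c' = m_inv (max_group e) (e \<cdot> c)" if c: "(c, c') \<in> set cs" for c c'
  proof (cases "c \<cdot> c = c")
    case True
    have "inverses c c'" using r(2) c by (auto simp: all_inverses_def)
    then have "c' = c" using inverses_of_idem True by blast
    then have "e \<cdot> c = e" using state c True by fastforce
    then show ?thesis using \<open>c' = c\<close> subgroup.one_closed[OF K] G.inv_one by simp
  next
    case False
    then have ce: "e = c \<cdot> c'" "e = c' \<cdot> c" using state c by auto
    have i: "inverses c c'" using r(2) c by (auto simp: all_inverses_def)
    then have S: "c \<in> S" "c' \<in> S" "c \<cdot> c' \<cdot> c = c" "c' \<cdot> c \<cdot> c' = c'" by (auto simp: inverses_def)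
    have "c \<in> K" using cs c False ce by (auto simp: K_def)
    moreover have "e \<cdot> c = c" using S ce by metis
    moreover have "e \<cdot> c' = c'" using S ce by metis
    moreover have "c \<in> max_subgroup e" "c' \<in> max_subgroup e"
      using max_subgroup_of_inverses[OF i] max_subgroup_of_inverses[OF inverses_sym[OF i]] ce by metis+
    then have "m_inv (max_group e) c = c'" using inv_max_group[OF e] ce by metis
    ultimately show ?thesis by simp
  qed
  then have "rprod e cs \<cdot> rprod e (map prod.swap cs) \<in> derived (max_group e) K" "rprod e cs \<in> K"
    using rprod_derived[OF e K r(2)] by blast+
  moreover have "r = rprod e cs \<cdot> rprod e (map prod.swap cs)"
  proof -
    have "rprod e cs \<in> max_subgroup e" using \<open>rprod e cs \<in> K\<close> subgroup.subset[OF K] by auto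
    then have "rprod e cs \<in> S" "rprod e cs \<cdot> e = rprod e cs" by (auto simp: max_subgroup_def)
    then have "rprod (rprod e cs) (map prod.swap cs) = rprod e cs \<cdot> rprod e (map prod.swap cs)"
      using rprod_mult[OF all_inverses_swap[OF r(2)], of "rprod e cs" e] eS by simp
    then show ?thesis using r(3) by simp
  qed
  ultimately have "r \<in> derived (max_group e) K" by metis
  moreover have "(derived (max_group e) ^^ Suc j) (max_subgroup e) = derived (max_group e) K" by (simp add: K_def)
  ultimately show ?thesis unfolding e_def by metis
qed

lemma derived_bound:
  assumes "subgroups_solvable S m"
  shows "\<exists>D. \<forall>e. idem e \<longrightarrow> (derived (max_group e) ^^ D) (max_subgroup e) \<subseteq> {e}"
proof -
  have "\<exists>d. (derived (max_group e) ^^ d) (max_subgroup e) \<subseteq> {e}" if e: "idem e" for e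
  proof -
    interpret G: group "max_group e" using group_max_group[OF e] .
    have "solvable (max_group e)"
      using assms G.group_axioms max_subgroup_in_S unfolding subgroups_solvable_def max_group_def by blast
    then show ?thesis using G.solvable_iff_trivial_derived_seq by auto
  qed
  then obtain d where d: "\<And>e. idem e \<Longrightarrow> (derived (max_group e) ^^ d e) (max_subgroup e) \<subseteq> {e}" by metis
  define D where "D = Max (d ` S)"
  have "(derived (max_group e) ^^ D) (max_subgroup e) \<subseteq> {e}" if e: "idem e" for e
  proof -
    interpret G: group "max_group e" using group_max_group[OF e] .
    have "d e \<le> D" using e fin by (auto simp: D_def idem_def)
    then obtain k where k: "D = k + d e" by (metis le_add_diff_inverse2)
    have triv: "(derived (max_group e) ^^ k) {e} \<subseteq> {e}"
    proof (induction k)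
      case (Suc k)
      then have "derived (max_group e) ((derived (max_group e) ^^ k) {e}) \<subseteq> {e}"
        using G.derived_incl[OF _ G.triv_subgroup] by simp
      then show ?case by simp
    qed simp
    have "(derived (max_group e) ^^ D) (max_subgroup e) = (derived (max_group e) ^^ k) ((derived (max_group e) ^^ d e) (max_subgroup e))"
      by (simp add: k funpow_add)
    also have "\<dots> \<subseteq> (derived (max_group e) ^^ k) {e}" using G.mono_exp_of_derived d[OF e] by blast
    finally show ?thesis using triv by blast
  qed
  then show ?thesis by blast
qed

text \<open>
  While the principal ideal of a non-idempotent value keeps its size from level to level, the values
  descend through the derived series of one maximal subgroup. Hence the size drops after at most
  \<open>D + 1\<close> levels, where \<open>D\<close> bounds the derived lengths.
\<close>

lemma levels_idem:
  fixes Z Z' :: "nat \<Rightarrow> 'v \<Rightarrow> 'a"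
  assumes D: "\<forall>e. idem e \<longrightarrow> (derived (max_group e) ^^ D) (max_subgroup e) \<subseteq> {e}"
    and V0: "\<And>v. v \<in> V \<Longrightarrow> inverses (Z 0 v) (Z' 0 v)"
    and V: "\<And>h v. v \<in> V \<Longrightarrow> \<exists>vs. set vs \<subseteq> V \<and>
      node (Z (Suc h) v) (Z' (Suc h) v) (map (\<lambda>u. (Z h u, Z' h u)) vs)"
    and v: "v \<in> V"
  shows "Z (card S * Suc D) v \<cdot> Z (card S * Suc D) v = Z (card S * Suc D) v"
proof -
  define P where "P h M \<longleftrightarrow> (\<forall>v\<in>V. Z h v \<cdot> Z h v \<noteq> Z h v \<longrightarrow> card (ideal (Z h v)) \<le> M)" for h M
  have ipZ: "inverses (Z h v) (Z' h v)" if "v \<in> V" for h v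
    using that V0 V unfolding node_def by (cases h) blast+
  have fin_ideal: "finite (ideal (Z h v))" if "v \<in> V" for h v
    using ideal_subset fin ipZ[OF that, of h] finite_subset unfolding inverses_def by blast
  have pos: "card (ideal (Z h v)) > 0" if "v \<in> V" for h v
    using fin_ideal[OF that] inverses_self[OF ipZ[OF that]] card_gt_0_iff by blast
  have child: "ideal (Z (Suc h) v) \<subseteq> ideal (Z h u)"
    if "node (Z (Suc h) v) (Z' (Suc h) v) (map (\<lambda>u. (Z h u, Z' h u)) vs)" "u \<in> set vs" for h v vs u
    using ideal_child[OF that(1)] that(2) by auto
  \<comment> \<open>A non-idempotent value has a non-idempotent factor one level below, by
    \<open>node_idem\<close>, and the ideal of that factor contains its own.\<close>
  have mono: "P (Suc h) M" if P: "P h M" for h M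
    unfolding P_def
  proof (intro ballI impI)
    fix v assume v: "v \<in> V" "Z (Suc h) v \<cdot> Z (Suc h) v \<noteq> Z (Suc h) v"
    obtain vs where vs: "set vs \<subseteq> V" "node (Z (Suc h) v) (Z' (Suc h) v) (map (\<lambda>u. (Z h u, Z' h u)) vs)"
      using V[OF v(1)] by blast
    obtain u where u: "u \<in> set vs" "Z h u \<cdot> Z h u \<noteq> Z h u"
      using node_idem[OF vs(2)] v(2) by auto
    have "card (ideal (Z (Suc h) v)) \<le> card (ideal (Z h u))"
      using child[OF vs(2) u(1)] fin_ideal u vs by (intro card_mono) auto
    also have "\<dots> \<le> M" using P u vs unfolding P_def by auto
    finally show "card (ideal (Z (Suc h) v)) \<le> M" .
  qed
  have mono_add: "P (h + k) M" if "P h M" for h k M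
    by (induction k) (use that mono in auto)
  \<comment> \<open>If the size is still \<open>M\<close>, the inclusions between the ideals are
    equalities. So every non-idempotent factor generates the ideal of \<open>r\<close>, as the walks
    require.\<close>
  have info: "\<exists>vs. set vs \<subseteq> V \<and> node r r' (map (\<lambda>u. (Z (h + j) u, Z' (h + j) u)) vs) \<and>
      idem_or_in_ideal (r \<cdot> r') (map (\<lambda>u. (Z (h + j) u, Z' (h + j) u)) vs) \<and>
      (\<forall>u\<in>set vs. Z (h + j) u \<cdot> Z (h + j) u \<noteq> Z (h + j) u \<longrightarrow> ideal (Z (h + j) u) = ideal r)"
    if P: "P h M" and v: "v \<in> V" and r: "r = Z (Suc (h + j)) v" "r' = Z' (Suc (h + j)) v" "card (ideal r) = M"
    for h M v r r' j
  proof -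
    obtain vs where vs: "set vs \<subseteq> V" "node r r' (map (\<lambda>u. (Z (h + j) u, Z' (h + j) u)) vs)"
      using V[OF v, of "h + j"] r by auto
    have ch: "ideal (Z (h + j) u) = ideal r" if "u \<in> set vs" "Z (h + j) u \<cdot> Z (h + j) u \<noteq> Z (h + j) u" for u
    proof -
      have u: "u \<in> V" using vs that by auto
      have "ideal r \<subseteq> ideal (Z (h + j) u)" using ideal_child[OF vs(2)] that by auto
      moreover have "card (ideal (Z (h + j) u)) \<le> M"
        using mono_add[OF P, of j] that u unfolding P_def by auto
      ultimately show ?thesis
        using card_seteq[OF fin_ideal[OF u]] r(3) by metis
    qed
    have inverses: "inverses r r'" using vs by (simp add: node_def)
    then have S: "r \<in> S" "r' \<in> S" "r \<cdot> r' \<cdot> r = r" by (auto simp: inverses_def)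
    have "r \<in> ideal (r \<cdot> r')"
    proof (rule idealI)
      show "r \<cdot> r' \<in> S" "r \<in> S" using S by auto
      show "r = r \<cdot> r' \<cdot> (r \<cdot> r') \<cdot> r" using S by (metis assoc closed)
    qed
    then have le: "ideal r \<subseteq> ideal (r \<cdot> r')" using ideal_trans S by blast
    have "Z (h + j) u \<in> ideal (r \<cdot> r')" if "u \<in> set vs" "Z (h + j) u \<cdot> Z (h + j) u \<noteq> Z (h + j) u" for u
      using inverses_self[OF ipZ, of u "h + j"] ch[OF that] le that(1) vs(1) by blast
    then have "idem_or_in_ideal (r \<cdot> r') (map (\<lambda>u. (Z (h + j) u, Z' (h + j) u)) vs)"
      unfolding idem_or_in_ideal_def by auto
    then show ?thesis using vs ch by blast
  qed
  have Q: "r \<cdot> r' = r' \<cdot> r \<and> r \<in> (derived (max_group (r \<cdot> r')) ^^ j) (max_subgroup (r \<cdot> r'))"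
    if P: "P h M" and "v \<in> V" "r = Z (Suc (h + j)) v" "r' = Z' (Suc (h + j)) v" "card (ideal r) = M"
    for h M v r r' j
    using that(2-)
  proof (induction j arbitrary: v r r')
    case 0
    then obtain cs where cs: "node r r' cs" "idem_or_in_ideal (r \<cdot> r') cs" using info[OF P, of v r 0 r'] by auto
    then show ?case using node_group[OF cs] max_subgroup_of_inverses unfolding node_def by simp
  next
    case (Suc j)
    obtain vs where vs: "set vs \<subseteq> V" "node r r' (map (\<lambda>u. (Z (h + Suc j) u, Z' (h + Suc j) u)) vs)"
      "idem_or_in_ideal (r \<cdot> r') (map (\<lambda>u. (Z (h + Suc j) u, Z' (h + Suc j) u)) vs)"
      "\<forall>u\<in>set vs. Z (h + Suc j) u \<cdot> Z (h + Suc j) u \<noteq> Z (h + Suc j) u \<longrightarrow> ideal (Z (h + Suc j) u) = ideal r"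
      using info[OF P Suc.prems] by blast
    have "c \<cdot> c' = c' \<cdot> c \<and> c \<in> (derived (max_group (c \<cdot> c')) ^^ j) (max_subgroup (c \<cdot> c'))"
      if c: "(c, c') \<in> set (map (\<lambda>u. (Z (h + Suc j) u, Z' (h + Suc j) u)) vs)" "c \<cdot> c \<noteq> c" for c c'
    proof -
      obtain u where u: "u \<in> set vs" "c = Z (Suc (h + j)) u" "c' = Z' (Suc (h + j)) u" using c by auto
      then have "card (ideal c) = M" using vs(4) c(2) Suc.prems(4) by auto
      then show ?thesis using Suc.IH[of u c c'] u vs(1) by blast
    qed
    then show ?case using node_group[OF vs(2,3)] node_derived[OF vs(2,3), of j] by blast
  qed
  have drop: "P (h + Suc D) (M - 1)" if P: "P h M" for h M
    unfolding P_def
  proof (intro ballI impI)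
    fix v assume v: "v \<in> V" "Z (h + Suc D) v \<cdot> Z (h + Suc D) v \<noteq> Z (h + Suc D) v"
    define r r' where "r = Z (h + Suc D) v" and "r' = Z' (h + Suc D) v"
    have "card (ideal r) \<noteq> M"
    proof
      assume "card (ideal r) = M"
      moreover have "r = Z (Suc (h + D)) v" "r' = Z' (Suc (h + D)) v" by (simp_all add: r_def r'_def)
      ultimately have "r \<in> (derived (max_group (r \<cdot> r')) ^^ D) (max_subgroup (r \<cdot> r'))"
        using Q[OF P v(1)] by blast
      moreover have "idem (r \<cdot> r')" using inverses_idem[OF ipZ[OF v(1)]] by (simp add: r_def r'_def)
      ultimately have "r = r \<cdot> r'" "idem (r \<cdot> r')" using D by blast+
      then show False using v(2) unfolding idem_def r_def[symmetric] by metis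
    qed
    moreover have "card (ideal r) \<le> M" using mono_add[OF P, of "Suc D"] v unfolding P_def r_def by blast
    ultimately show "card (ideal (Z (h + Suc D) v)) \<le> M - 1" by (simp add: r_def)
  qed
  have "P (k * Suc D) (card S - k)" for k
  proof (induction k)
    case 0
    have "card (ideal (Z 0 v)) \<le> card S" if "v \<in> V" for v
      using ideal_subset[of "Z 0 v"] V0[OF that] fin by (intro card_mono) (auto simp: inverses_def)
    then show ?case by (simp add: P_def)
  next
    case (Suc k)
    have "Suc k * Suc D = k * Suc D + Suc D" "card S - Suc k = card S - k - 1" by simp_all
    then show ?case using drop[OF Suc] by (simp only:)
  qed
  \<comment> \<open>The bound has reached 0, whereas the ideal of a value is never empty.\<close>
  from this[of "card S"] show ?thesis using v pos[OF v, of "card S * Suc D"] unfolding P_def by auto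
qed

end

section \<open>The words\<close>

primrec rename :: "(nat \<Rightarrow> nat) \<Rightarrow> trm \<Rightarrow> trm" where
  "rename f (Var x) = Var (f x)"
| "rename f (Add s t) = Add (rename f s) (rename f t)"
| "rename f (Mul s t) = Mul (rename f s) (rename f t)"

primrec tpow :: "trm \<Rightarrow> nat \<Rightarrow> trm" where
  "tpow t 0 = t"
| "tpow t (Suc k) = Mul (tpow t k) t"

text \<open>Meant for nonempty lists, since the signature has no unit to serve as an empty
  product.\<close>

definition tprod :: "trm list \<Rightarrow> trm" where
  "tprod ts = foldl Mul (hd ts) (tl ts)"

text \<open>
  If the power of \<open>u u'\<close> with exponent \<open>K + 1\<close> is idempotent, then \<open>bar K u u'\<close> and \<open>bar_inv K u u'\<close> are
  mutually inverse in the sense of \<open>inverses\<close>. If \<open>u\<close> and \<open>u'\<close> are partial injections inverse to each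
  other, they are returned unchanged.
\<close>

definition bar :: "nat \<Rightarrow> trm \<Rightarrow> trm \<Rightarrow> trm" where
  "bar K u u' = Mul (tpow (Mul u u') K) u"

definition bar_inv :: "nat \<Rightarrow> trm \<Rightarrow> trm \<Rightarrow> trm" where
  "bar_inv K u u' = Mul u' (tpow (Mul u u') (2 * K))"

definition blocks :: "nat \<Rightarrow> trm \<Rightarrow> trm list" where
  "blocks n t = map (\<lambda>l. rename (\<lambda>x. prod_encode (l, x)) t) [0..<n]"

text \<open>
  With \<open>w\<^sub>l\<close> the word of level \<open>h\<close> over the \<open>l\<close>-th copy of the alphabet, \<open>u\<close> stands for
  \<open>w\<^sub>1 \<dots> w\<^sub>n w\<^sub>1\<inverse> \<dots> w\<^sub>n\<inverse>\<close> and \<open>u'\<close> for its formal inverse \<open>w\<^sub>n \<dots> w\<^sub>1 w\<^sub>n\<inverse> \<dots> w\<^sub>1\<inverse>\<close>.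
  The second component of \<open>word\<close> plays the role of the inverse of the first.
\<close>

primrec word :: "nat \<Rightarrow> nat \<Rightarrow> nat \<Rightarrow> trm \<times> trm" where
  "word K n 0 = (bar K (Var 0) (Var 1), bar_inv K (Var 0) (Var 1))"
| "word K n (Suc h) =
    (let p = blocks n (fst (word K n h)); q = blocks n (snd (word K n h));
         u = tprod (p @ q); u' = tprod (rev p @ rev q)
     in (bar K u u', bar_inv K u u'))"

section \<open>Evaluating the words in a block-group\<close>

lemma eval_rename: "eval_trm A v (rename f t) = eval_trm A (\<lambda>x. v (f x)) t"
  by (induction t) auto

lemma eval_tpow: "eval_trm A v (tpow t k) = power_Suc (mul_op A) (eval_trm A v t) k"
  by (induction k) auto

lemma eval_foldl: "eval_trm A v (foldl Mul t ts) = foldl (mul_op A) (eval_trm A v t) (map (eval_trm A v) ts)"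
  by (induction ts arbitrary: t) auto

lemma eval_tprod: "ts \<noteq> [] \<Longrightarrow> eval_trm A v (tprod ts) = foldl (mul_op A) (hd (map (eval_trm A v) ts)) (tl (map (eval_trm A v) ts))"
  by (simp add: tprod_def eval_foldl hd_map map_tl)

lemma eval_closed:
  assumes "is_alg22 A" "range v \<subseteq> carrier A"
  shows "eval_trm A v t \<in> carrier A"
  using assms by (induction t) (auto simp: is_alg22_def)

context finite_block_group
begin

text \<open>The product of the two elements is a power of \<open>u \<cdot> u'\<close> with exponent
  \<open>(K + 1) + 1 + (2 * K + 1) = 3 * (K + 1)\<close>, hence the idempotent power again. The
  exponent \<open>2 * K + 1\<close> is positive even for \<open>K = 0\<close>.\<close>

lemma bar_inverses:
  assumes u: "u \<in> S" "u' \<in> S" and K: "idem (power_Suc m (u \<cdot> u') K)"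
  shows "inverses (power_Suc m (u \<cdot> u') K \<cdot> u) (u' \<cdot> power_Suc m (u \<cdot> u') (2 * K))"
    "power_Suc m (u \<cdot> u') K \<cdot> u \<cdot> (u' \<cdot> power_Suc m (u \<cdot> u') (2 * K)) = power_Suc m (u \<cdot> u') K"
proof -
  define c where "c = u \<cdot> u'"
  have c: "c \<in> S" using u by (simp add: c_def)
  have p: "power_Suc m c k \<in> S" for k using c by simp
  have id: "power_Suc m c K \<cdot> power_Suc m c K = power_Suc m c K" using K by (simp add: idem_def c_def)
  have "power_Suc m c K \<cdot> u \<cdot> (u' \<cdot> power_Suc m c (2 * K)) = power_Suc m c K \<cdot> (power_Suc m c 0 \<cdot> power_Suc m c (2 * K))"
    using u p[of K] p[of "2 * K"] by (simp add: c_def assoc)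
  also have "\<dots> = power_Suc m c K \<cdot> power_Suc m c (Suc (2 * K))" using power_Suc_add[OF c, of 0 "2 * K"] by simp
  also have "power_Suc m c (Suc (2 * K)) = power_Suc m c K \<cdot> power_Suc m c K" using power_Suc_add[OF c, of K K] by (simp add: mult_2)
  finally show eq: "power_Suc m (u \<cdot> u') K \<cdot> u \<cdot> (u' \<cdot> power_Suc m (u \<cdot> u') (2 * K)) = power_Suc m (u \<cdot> u') K"
    using id by (simp flip: c_def)
  have "power_Suc m c K \<cdot> (power_Suc m c K \<cdot> u) = power_Suc m c K \<cdot> u" using id p u by (simp flip: assoc)
  moreover have "u' \<cdot> power_Suc m c (2 * K) \<cdot> power_Suc m c K = u' \<cdot> power_Suc m c (2 * K)"
  proof (cases K)
    case 0
    then show ?thesis using id p[of 0] u by (simp add: assoc)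
  next
    case (Suc k)
    have "power_Suc m c (2 * K) = power_Suc m c k \<cdot> power_Suc m c K"
      using power_Suc_add[OF c, of k K] Suc by (simp add: mult_2)
    then have "power_Suc m c (2 * K) \<cdot> power_Suc m c K = power_Suc m c (2 * K)" using id p[of k] p[of K] by (simp add: assoc)
    then show ?thesis using u p[of "2 * K"] p[of K] by (simp add: assoc)
  qed
  ultimately show "inverses (power_Suc m (u \<cdot> u') K \<cdot> u) (u' \<cdot> power_Suc m (u \<cdot> u') (2 * K))"
    unfolding inverses_def using eq u p by (simp add: assoc flip: c_def)
qed

lemma foldl_mult:
  assumes "x \<in> S" "y \<in> S" "set ys \<subseteq> S"
  shows "x \<cdot> foldl (\<cdot>) y ys = foldl (\<cdot>) (x \<cdot> y) ys"
  using assms by (induction ys arbitrary: y) (auto simp: assoc)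

end

lemma block_group_word:
  fixes A :: "'a alg22"
  assumes A: "is_alg22 A" "finite (carrier A)" and bg: "block_group (carrier A) (mul_op A)"
    and sol: "subgroups_solvable (carrier A) (mul_op A)"
  shows "\<exists>K h. \<forall>n>0. holds_in (fst (word K n h), Mul (fst (word K n h)) (fst (word K n h))) A"
proof -
  interpret finite_block_group "carrier A" "mul_op A" by unfold_locales fact+
  obtain D where D: "\<forall>e. idem e \<longrightarrow> (derived (max_group e) ^^ D) (max_subgroup e) \<subseteq> {e}"
    using derived_bound[OF sol] by blast
  obtain K where K: "\<forall>x\<in>carrier A. idem (power_Suc (mul_op A) x K)" using idem_power by blast
  define h where "h = card (carrier A) * Suc D"
  have "holds_in (fst (word K n h), Mul (fst (word K n h)) (fst (word K n h))) A" if n: "n > 0" for n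
    unfolding holds_in_def
  proof (intro allI impI)
    fix v0 :: "nat \<Rightarrow> 'a" assume v0: "range v0 \<subseteq> carrier A"
    define V where "V = {v :: nat \<Rightarrow> 'a. range v \<subseteq> carrier A}"
    define Z where "Z h v = eval_trm A v (fst (word K n h))" for h v
    define Z' where "Z' h v = eval_trm A v (snd (word K n h))" for h v
    have ev: "eval_trm A v t \<in> carrier A" if "v \<in> V" for v t using eval_closed A that by (simp add: V_def)
    have bars: "inverses (eval_trm A v (bar K u u')) (eval_trm A v (bar_inv K u u'))"
      "eval_trm A v (bar K u u') = mul_op A (mul_op A (eval_trm A v (bar K u u')) (eval_trm A v (bar_inv K u u'))) (eval_trm A v u)"
      if "v \<in> V" for v u u'
    proof -
      note b = bar_inverses[OF ev[OF that, of u] ev[OF that, of u']]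
      have "idem (power_Suc (mul_op A) (mul_op A (eval_trm A v u) (eval_trm A v u')) K)"
        using K ev[OF that] by simp
      note b = b[OF this]
      show "inverses (eval_trm A v (bar K u u')) (eval_trm A v (bar_inv K u u'))"
        using b by (simp add: bar_def bar_inv_def eval_tpow)
      show "eval_trm A v (bar K u u') = mul_op A (mul_op A (eval_trm A v (bar K u u')) (eval_trm A v (bar_inv K u u'))) (eval_trm A v u)"
        using b by (simp add: bar_def bar_inv_def eval_tpow)
    qed
    have "mul_op A (Z h v0) (Z h v0) = Z h v0"
      unfolding h_def
    proof (rule levels_idem[where V = V and Z = Z and Z' = Z', OF D])
      show "v0 \<in> V" using v0 by (simp add: V_def)
      show "inverses (Z 0 v) (Z' 0 v)" if "v \<in> V" for v
        using bars(1)[OF that] by (simp add: Z_def Z'_def)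
      fix h v assume v: "v \<in> V"
      \<comment> \<open>Block \<open>l\<close> of the next word under \<open>v\<close> is the
        current word under a shifted valuation. This is why the levels are indexed by all
        valuations, and why the bound \<open>h\<close> is independent of \<open>n\<close>.\<close>
      define vs where "vs = map (\<lambda>l x. v (prod_encode (l, x))) [0..<n]"
      define cs where "cs = map (\<lambda>u. (Z h u, Z' h u)) vs"
      have vsV: "set vs \<subseteq> V" using v by (auto simp: vs_def V_def)
      have ipZ: "inverses (Z h u) (Z' h u)" if "u \<in> V" for u h
        using that by (cases h) (simp_all add: Z_def Z'_def bars(1) Let_def)
      have all_inverses: "all_inverses cs" using ipZ vsV by (auto simp: all_inverses_def cs_def)
      have "node (Z (Suc h) v) (Z' (Suc h) v) cs"
        unfolding node_def
      proof (intro conjI)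
        show inverses: "inverses (Z (Suc h) v) (Z' (Suc h) v)" by (rule ipZ[OF v])
        show "all_inverses cs" by (rule all_inverses)
        define p where "p = blocks n (fst (word K n h))"
        define q where "q = blocks n (snd (word K n h))"
        define e where "e = mul_op A (Z (Suc h) v) (Z' (Suc h) v)"
        have e: "e \<in> carrier A" using inverses by (simp add: e_def inverses_def)
        have mp: "map (eval_trm A v) (p @ q) = map fst (cs @ map prod.swap cs)"
          by (simp add: p_def q_def blocks_def cs_def vs_def Z_def Z'_def eval_rename)
        have ne: "p @ q \<noteq> []" using n by (simp add: p_def blocks_def)
        then obtain y ys where ys: "map (eval_trm A v) (p @ q) = y # ys" by (cases "p @ q") auto
        have "set (y # ys) \<subseteq> carrier A" unfolding ys[symmetric] using ev[OF v] by auto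
        then have yS: "y \<in> carrier A" "set ys \<subseteq> carrier A" by auto
        have "Z (Suc h) v = mul_op A e (eval_trm A v (tprod (p @ q)))"
          using bars(2)[OF v, of "tprod (p @ q)" "tprod (rev p @ rev q)"]
          by (simp add: Z_def Z'_def e_def p_def q_def Let_def)
        also have "\<dots> = mul_op A e (foldl (mul_op A) y ys)" using eval_tprod[OF ne, of A v] ys by simp
        also have "\<dots> = foldl (mul_op A) e (y # ys)" using foldl_mult[OF e yS] by simp
        also have "\<dots> = rprod e (cs @ map prod.swap cs)"
          unfolding ys[symmetric] mp rprod_def by (simp only: foldl_map)
        finally show "Z (Suc h) v = rprod (mul_op A (Z (Suc h) v) (Z' (Suc h) v)) (cs @ map prod.swap cs)"
          by (simp only: e_def)
      qed
      then show "\<exists>vs. set vs \<subseteq> V \<and> node (Z (Suc h) v) (Z' (Suc h) v) (map (\<lambda>u. (Z h u, Z' h u)) vs)"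
        using vsV unfolding cs_def by blast
    qed
    then show "eval_trm A v0 (fst (fst (word K n h), Mul (fst (word K n h)) (fst (word K n h)))) =
        eval_trm A v0 (snd (fst (word K n h), Mul (fst (word K n h)) (fst (word K n h))))"
      by (simp add: Z_def)
  qed
  then show ?thesis by blast
qed

section \<open>Transfer of identities\<close>

primrec vars :: "trm \<Rightarrow> nat set" where
  "vars (Var x) = {x}"
| "vars (Add s t) = vars s \<union> vars t"
| "vars (Mul s t) = vars s \<union> vars t"

lemma finite_vars: "finite (vars t)"
  by (induction t) auto

definition rel_alg :: "('a \<times> 'a) set set \<Rightarrow> ('a \<times> 'a) set alg22" where
  "rel_alg C = \<lparr>carrier = C, add_op = (\<inter>), mul_op = (O)\<rparr>"

lemma rel_alg_simps [simp]: "carrier (rel_alg C) = C" "add_op (rel_alg C) = (\<inter>)" "mul_op (rel_alg C) = (O)"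
  by (simp_all add: rel_alg_def)

text \<open>
  The semiring \<open>B21\<close> in terms of relations on \<open>bool\<close>: matrix multiplication is composition and the
  Hadamard product is intersection.
\<close>

definition bool_rels :: "(bool \<times> bool) set set" where
  "bool_rels = {{}, Id, {(False, True)}, {(True, False)}, {(False, False)}, {(True, True)}}"

definition rel_mat :: "(bool \<times> bool) set \<Rightarrow> int ^ 2 ^ 2" where
  "rel_mat r = mat22 (of_bool ((False, False) \<in> r)) (of_bool ((False, True) \<in> r))
    (of_bool ((True, False) \<in> r)) (of_bool ((True, True) \<in> r))"

lemma mat22_eq_iff: "mat22 a b c d = mat22 a' b' c' d' \<longleftrightarrow> a = a' \<and> b = b' \<and> c = c' \<and> d = d'"
  by (auto simp: mat22_def vec_eq_iff forall_2)

lemma rel_mat_inj: "rel_mat r = rel_mat s \<Longrightarrow> r = s"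
proof -
  assume "rel_mat r = rel_mat s"
  then have "(a, b) \<in> r \<longleftrightarrow> (a, b) \<in> s" for a b
    by (cases a; cases b) (auto simp: rel_mat_def mat22_eq_iff of_bool_def split: if_splits)
  then show "r = s" by auto
qed

lemma rel_mat_Int: "rel_mat (r \<inter> s) = hadamard (rel_mat r) (rel_mat s)"
  by (simp add: rel_mat_def hadamard_mat22 of_bool_conj)

lemma bool_rels_single_valued: "r \<in> bool_rels \<Longrightarrow> (a, b) \<in> r \<Longrightarrow> (a, c) \<in> r \<Longrightarrow> b = c"
  by (auto simp: bool_rels_def)

lemma relcomp_bool_iff: "(a, b) \<in> r O s \<longleftrightarrow> (a, False) \<in> r \<and> (False, b) \<in> s \<or> (a, True) \<in> r \<and> (True, b) \<in> s"
  by (metis (full_types) relcomp.simps relcompI)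

lemma rel_mat_relcomp:
  assumes "r \<in> bool_rels"
  shows "rel_mat (r O s) = rel_mat r ** rel_mat s"
  unfolding rel_mat_def mat22_mult relcomp_bool_iff
  using assms by (auto simp: bool_rels_def mat22_eq_iff)

lemma bool_rels_Int: "r \<in> bool_rels \<Longrightarrow> s \<in> bool_rels \<Longrightarrow> r \<inter> s \<in> bool_rels"
  by (auto simp: bool_rels_def)

lemma pair_relcomp: "{(a, b)} O {(c, d)} = (if b = c then {(a, d)} else {})"
  by auto

lemma bool_rels_relcomp: "r \<in> bool_rels \<Longrightarrow> s \<in> bool_rels \<Longrightarrow> r O s \<in> bool_rels"
  unfolding bool_rels_def insert_iff empty_iff by (elim disjE FalseE; simp add: pair_relcomp)

lemma rel_mat_carrier: "r \<in> bool_rels \<Longrightarrow> rel_mat r \<in> carrier B21"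
  by (auto simp: bool_rels_def rel_mat_def B21_def)

lemma eval_bool_rels: "range e \<subseteq> bool_rels \<Longrightarrow> eval_trm (rel_alg C) e t \<in> bool_rels"
  by (induction t) (auto intro: bool_rels_Int bool_rels_relcomp)

lemma eval_rel_mat:
  assumes "range e \<subseteq> bool_rels"
  shows "eval_trm B21 (\<lambda>x. rel_mat (e x)) t = rel_mat (eval_trm (rel_alg C) e t)"
  using eval_bool_rels[OF assms, of C]
  by (induction t) (simp_all add: B21_def rel_mat_Int rel_mat_relcomp)

lemma B21_identity_bool_rels:
  assumes "(s, t) \<in> identities_of B21" "range e \<subseteq> bool_rels"
  shows "eval_trm (rel_alg C) e s = eval_trm (rel_alg C) e t"
proof -
  have "range (\<lambda>x. rel_mat (e x)) \<subseteq> carrier B21" using assms(2) rel_mat_carrier by blast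
  then have "eval_trm B21 (\<lambda>x. rel_mat (e x)) s = eval_trm B21 (\<lambda>x. rel_mat (e x)) t"
    using assms(1) by (simp add: identities_of_def holds_in_def)
  then show ?thesis unfolding eval_rel_mat[OF assms(2), where C = C] by (rule rel_mat_inj)
qed

text \<open>Variables outside \<open>V\<close> get the empty relation, so that the whole valuation
  has values in \<open>bool_rels\<close> although \<open>admissible\<close> constrains only
  \<open>V\<close>.\<close>

definition image_rel :: "(nat \<Rightarrow> bool) \<Rightarrow> nat set \<Rightarrow> (nat \<Rightarrow> (nat \<times> nat) set) \<Rightarrow> nat \<Rightarrow> (bool \<times> bool) set" where
  "image_rel \<phi> V w x = (if x \<in> V then map_prod \<phi> \<phi> ` w x else {})"

lemma subset_Id_bool_rels: "r \<subseteq> Id \<Longrightarrow> r \<in> bool_rels"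
proof -
  assume r: "r \<subseteq> (Id :: (bool \<times> bool) set)"
  have I: "(Id :: (bool \<times> bool) set) = {(False, False), (True, True)}" by auto
  have "r = (if (False, False) \<in> r then {(False, False)} else {}) \<union> (if (True, True) \<in> r then {(True, True)} else {})"
    using r unfolding I by (auto split: if_splits)
  then show "r \<in> bool_rels" unfolding bool_rels_def I
    by (cases "(False, False) \<in> r"; cases "(True, True) \<in> r") auto
qed

lemma compatible_image:
  assumes "compatible \<phi> y"
  shows "map_prod \<phi> \<phi> ` y \<in> bool_rels"
proof (cases "\<forall>(a, b)\<in>y. \<phi> a = \<phi> b")
  case True
  then show ?thesis by (intro subset_Id_bool_rels) auto
next
  case False
  then obtain c where c: "\<forall>(a, b)\<in>y. \<phi> a = c \<and> \<phi> b = (\<not> c)" using assms by (auto simp: compatible_def)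
  then have "map_prod \<phi> \<phi> ` y \<subseteq> {(c, \<not> c)}" by auto
  then have "map_prod \<phi> \<phi> ` y = {} \<or> map_prod \<phi> \<phi> ` y = {(c, \<not> c)}" by (rule subset_singletonD)
  moreover have "{} \<in> bool_rels" "{(c, \<not> c)} \<in> bool_rels" by (cases c; simp add: bool_rels_def)+
  ultimately show ?thesis by (elim disjE) (simp_all only:)
qed

lemma image_rel_bool_rels: "admissible V w \<phi> \<Longrightarrow> range (image_rel \<phi> V w) \<subseteq> bool_rels"
proof -
  assume "admissible V w \<phi>"
  then have "image_rel \<phi> V w x \<in> bool_rels" for x
    using compatible_image unfolding image_rel_def admissible_def by (simp add: bool_rels_def)
  then show ?thesis by blast
qed

text \<open>Only an inclusion can be expected: \<phi> may identify points, so that evaluating the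
  images produces pairs with no preimage. \<open>eval_lift\<close> repairs this by using all
  admissible functions together.\<close>

lemma eval_image:
  assumes "vars t \<subseteq> V" "(p, q) \<in> eval_trm (rel_alg C) w t"
  shows "(\<phi> p, \<phi> q) \<in> eval_trm (rel_alg C') (image_rel \<phi> V w) t"
  using assms
proof (induction t arbitrary: p q)
  case (Var x)
  then show ?case by (force simp: image_rel_def)
next
  case (Mul s t)
  then obtain r where "(p, r) \<in> eval_trm (rel_alg C) w s" "(r, q) \<in> eval_trm (rel_alg C) w t" by auto
  then have "(\<phi> p, \<phi> r) \<in> eval_trm (rel_alg C') (image_rel \<phi> V w) s"
    "(\<phi> r, \<phi> q) \<in> eval_trm (rel_alg C') (image_rel \<phi> V w) t"
    using Mul.IH Mul.prems(1) by simp_all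
  then show ?case unfolding eval_trm.simps rel_alg_simps by (rule relcompI)
qed auto

text \<open>A variable is handled by the domain condition of \<open>separating\<close>. For a sum,
  different end points \<open>q\<close> and \<open>q'\<close> would be separated by some \<phi>,
  contrary to the single-valuedness of the images. For a product, single-valuedness identifies the
  intermediate point of every image with the image of \<open>q\<close>.\<close>

lemma eval_lift:
  assumes sep: "separating N V w" and bnd: "\<And>x. x \<in> V \<Longrightarrow> w x \<subseteq> {..N} \<times> {..N}"
    and "vars t \<subseteq> V" "p \<le> N"
    and "\<And>\<phi>. admissible V w \<phi> \<Longrightarrow> \<phi> p \<in> Domain (eval_trm (rel_alg C') (image_rel \<phi> V w) t)"
  shows "\<exists>q\<le>N. (p, q) \<in> eval_trm (rel_alg C) w t"
  using assms(3-)
proof (induction t arbitrary: p)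
  case (Var x)
  have x: "x \<in> V" using Var by simp
  have "p \<in> Domain (w x)"
  proof (rule ccontr)
    assume "p \<notin> Domain (w x)"
    then obtain \<phi> where \<phi>: "admissible V w \<phi>" "\<phi> p \<notin> \<phi> ` Domain (w x)"
      using sep x Var.prems(2) unfolding separating_def by blast
    have "\<phi> p \<in> Domain (map_prod \<phi> \<phi> ` w x)" using Var.prems(3)[OF \<phi>(1)] x by (simp add: image_rel_def)
    then have "\<phi> p \<in> \<phi> ` Domain (w x)" by force
    then show False using \<phi>(2) by contradiction
  qed
  then show ?case using bnd[OF x] by auto
next
  case (Add s t)
  obtain q where q: "q \<le> N" "(p, q) \<in> eval_trm (rel_alg C) w s"
    using Add.IH(1)[of p] Add.prems by force
  obtain q' where q': "q' \<le> N" "(p, q') \<in> eval_trm (rel_alg C) w t"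
    using Add.IH(2)[of p] Add.prems by force
  have "q = q'"
  proof (rule ccontr)
    assume "q \<noteq> q'"
    then obtain \<phi> where \<phi>: "admissible V w \<phi>" "\<phi> q \<noteq> \<phi> q'" using sep q q' unfolding separating_def by blast
    note R = eval_bool_rels[OF image_rel_bool_rels[OF \<phi>(1)], of C']
    obtain b where b: "(\<phi> p, b) \<in> eval_trm (rel_alg C') (image_rel \<phi> V w) s"
      "(\<phi> p, b) \<in> eval_trm (rel_alg C') (image_rel \<phi> V w) t"
      using Add.prems(3)[OF \<phi>(1)] by auto
    have "(\<phi> p, \<phi> q) \<in> eval_trm (rel_alg C') (image_rel \<phi> V w) s"
      "(\<phi> p, \<phi> q') \<in> eval_trm (rel_alg C') (image_rel \<phi> V w) t"
      using eval_image q q' Add.prems(1) by auto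
    then show False using b bool_rels_single_valued[OF R] \<phi>(2) by blast
  qed
  then show ?case using q q' by auto
next
  case (Mul s t)
  obtain q where q: "q \<le> N" "(p, q) \<in> eval_trm (rel_alg C) w s"
    using Mul.IH(1)[of p] Mul.prems by force
  have "\<phi> q \<in> Domain (eval_trm (rel_alg C') (image_rel \<phi> V w) t)" if \<phi>: "admissible V w \<phi>" for \<phi>
  proof -
    note R = eval_bool_rels[OF image_rel_bool_rels[OF \<phi>], of C']
    obtain b where b: "(\<phi> p, b) \<in> eval_trm (rel_alg C') (image_rel \<phi> V w) s"
      "b \<in> Domain (eval_trm (rel_alg C') (image_rel \<phi> V w) t)"
      using Mul.prems(3)[OF \<phi>] by auto
    have "(\<phi> p, \<phi> q) \<in> eval_trm (rel_alg C') (image_rel \<phi> V w) s"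
      using eval_image q Mul.prems(1) by auto
    then have "\<phi> q = b" using bool_rels_single_valued[OF R] b(1) by blast
    then show ?thesis using b(2) by simp
  qed
  then obtain r where "r \<le> N" "(q, r) \<in> eval_trm (rel_alg C) w t"
    using Mul.IH(2)[of q] Mul.prems q by auto
  then show ?case using q by auto
qed

lemma eval_bounded:
  assumes "\<And>x. x \<in> vars t \<Longrightarrow> w x \<subseteq> {..N} \<times> {..N}"
  shows "eval_trm (rel_alg C) w t \<subseteq> {..N} \<times> {..N}"
  using assms
proof (induction t)
  case (Var x)
  then show ?case by simp
next
  case (Add s t)
  then have "eval_trm (rel_alg C) w s \<subseteq> {..N} \<times> {..N}" by simp
  then show ?case unfolding eval_trm.simps rel_alg_simps by (rule le_infI1)
next
  case (Mul s t)
  then have "eval_trm (rel_alg C) w s \<subseteq> {..N} \<times> {..N}" "eval_trm (rel_alg C) w t \<subseteq> {..N} \<times> {..N}"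
    by simp_all
  then show ?case unfolding eval_trm.simps rel_alg_simps by blast
qed

lemma B21_identity_separating:
  assumes id: "(s, t) \<in> identities_of B21" and sep: "separating N V w"
    and bnd: "\<And>x. x \<in> V \<Longrightarrow> w x \<subseteq> {..N} \<times> {..N}" and V: "vars s \<subseteq> V" "vars t \<subseteq> V"
  shows "eval_trm (rel_alg C) w s \<subseteq> eval_trm (rel_alg C) w t"
proof (rule subrelI)
  fix p q assume pq: "(p, q) \<in> eval_trm (rel_alg C) w s"
  then have N: "p \<le> N" "q \<le> N" using eval_bounded[of s w N C] bnd V by auto
  have im: "(\<phi> p, \<phi> q) \<in> eval_trm (rel_alg {}) (image_rel \<phi> V w) t" if "admissible V w \<phi>" for \<phi>
    using eval_image[OF V(1) pq, of \<phi> "{}"] B21_identity_bool_rels[OF id image_rel_bool_rels[OF that], of "{}"]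
    by simp
  then obtain q' where q': "q' \<le> N" "(p, q') \<in> eval_trm (rel_alg C) w t"
    using eval_lift[OF sep bnd V(2) N(1), of "{}" C] by blast
  have "q = q'"
  proof (rule ccontr)
    assume "q \<noteq> q'"
    then obtain \<phi> where \<phi>: "admissible V w \<phi>" "\<phi> q \<noteq> \<phi> q'" using sep N q' unfolding separating_def by blast
    then show False
      using bool_rels_single_valued[OF eval_bool_rels[OF image_rel_bool_rels[OF \<phi>(1)]] im[OF \<phi>(1)]]
        eval_image[OF V(2) q'(2), of \<phi> "{}"] by blast
  qed
  then show "(p, q) \<in> eval_trm (rel_alg C) w t" using q'(2) by simp
qed

lemma B21_identity_path_rels:
  assumes id: "(s, t) \<in> identities_of B21" and n: "3 \<le> n" "card (vars s \<union> vars t) < n"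
  shows "holds_in (s, t) (rel_alg (path_rels n h))"
  unfolding holds_in_def
proof (intro allI impI)
  fix w :: "nat \<Rightarrow> (nat \<times> nat) set" assume w: "range w \<subseteq> carrier (rel_alg (path_rels n h))"
  let ?V = "vars s \<union> vars t"
  have w': "w x \<in> path_rels n h" for x using w by auto
  have sep: "separating (path_len n h) ?V w"
    using finite_vars n w' by (intro separating_path_rels) auto
  have id': "(t, s) \<in> identities_of B21" using id by (auto simp: identities_of_def holds_in_def)
  show "eval_trm (rel_alg (path_rels n h)) w (fst (s, t)) = eval_trm (rel_alg (path_rels n h)) w (snd (s, t))"
    using B21_identity_separating[OF id sep path_rels_bounded[OF w']]
      B21_identity_separating[OF id' sep path_rels_bounded[OF w']]
    by (simp add: subset_antisym)
qed

text \<open>At level 0 the variables 0 and 1 are a letter and its formal inverse. At higher levels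
  the decoding undoes the renaming in \<open>blocks\<close>; one letter acts on both copies of its
  block.\<close>

primrec letter_rel :: "nat \<Rightarrow> nat \<Rightarrow> nat \<Rightarrow> (nat \<times> nat) set" where
  "letter_rel n 0 = (\<lambda>x. if x = 0 then {(0, 1)} else if x = 1 then {(1, 0)} else {})"
| "letter_rel n (Suc h) = (\<lambda>z. let (l, x) = prod_decode z in if l < n then double n (path_len n h) l (letter_rel n h x) else {})"

lemma letter_rel_path_rels: "letter_rel n h x \<in> path_rels n h"
proof (induction h arbitrary: x)
  case 0
  then show ?case by (auto simp: rank1_def)
next
  case (Suc h)
  have "{} \<in> path_rels n (Suc h)" by (rule rank1_in_path_rels) (simp add: rank1_def)
  then show ?case using Suc double_in_path_rels by (auto simp: Let_def split: prod.split simp del: path_rels.simps)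
qed

lemma eval_double:
  assumes "(a, b) \<in> eval_trm (rel_alg C) v t" "c \<in> {l, n + l}"
  shows "(copy_pt n L c a, copy_pt n L c b) \<in> eval_trm (rel_alg C') (\<lambda>x. double n L l (v x)) t"
  using assms(1)
proof (induction t arbitrary: a b)
  case (Var x)
  then show ?case using assms(2) by (auto intro: doubleI)
next
  case (Mul s t)
  then obtain r where "(a, r) \<in> eval_trm (rel_alg C) v s" "(r, b) \<in> eval_trm (rel_alg C) v t" by auto
  then show ?case unfolding eval_trm.simps rel_alg_simps using Mul.IH by (blast intro: relcompI)
qed auto

lemma eval_tprod_path:
  assumes "ts \<noteq> []" "\<And>k. k < length ts \<Longrightarrow> (f k, f (Suc k)) \<in> eval_trm (rel_alg C) v (ts ! k)"
  shows "(f 0, f (length ts)) \<in> eval_trm (rel_alg C) v (tprod ts)"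
proof -
  obtain t ts' where ts: "ts = t # ts'" using assms(1) by (cases ts) auto
  have "(f 0, f (Suc (length us))) \<in> eval_trm (rel_alg C) v (foldl Mul t us)" if "\<exists>vs. ts' = us @ vs" for us
    using that
  proof (induction us rule: rev_induct)
    case Nil
    then show ?case using assms(2)[of 0] ts by simp
  next
    case (snoc u us)
    then obtain vs where vs: "ts' = us @ u # vs" by auto
    then have "(f (Suc (length us)), f (Suc (Suc (length us)))) \<in> eval_trm (rel_alg C) v u"
      using assms(2)[of "Suc (length us)"] ts by simp
    moreover have "(f 0, f (Suc (length us))) \<in> eval_trm (rel_alg C) v (foldl Mul t us)"
      using snoc.IH vs by auto
    ultimately show ?case by auto
  qed
  from this[of ts'] show ?thesis by (simp add: ts tprod_def)
qed

lemma eval_bar_path: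
  assumes "(a, b) \<in> eval_trm (rel_alg C) v u" "(b, a) \<in> eval_trm (rel_alg C) v u'"
  shows "(a, b) \<in> eval_trm (rel_alg C) v (bar K u u')" "(b, a) \<in> eval_trm (rel_alg C) v (bar_inv K u u')"
proof -
  have "(a, a) \<in> eval_trm (rel_alg C) v (tpow (Mul u u') k)" for k
    using assms by (induction k) auto
  then show "(a, b) \<in> eval_trm (rel_alg C) v (bar K u u')" "(b, a) \<in> eval_trm (rel_alg C) v (bar_inv K u u')"
    using assms unfolding bar_def bar_inv_def by auto
qed

lemma word_path:
  assumes n: "n > 0"
  shows "(0, path_len n h) \<in> eval_trm (rel_alg C) (letter_rel n h) (fst (word K n h)) \<and>
    (path_len n h, 0) \<in> eval_trm (rel_alg C) (letter_rel n h) (snd (word K n h))"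
proof (induction h)
  case 0
  show ?case using eval_bar_path[of 0 1 C "letter_rel n 0" "Var 0" "Var 1" K] by simp
next
  case (Suc h)
  define L where "L = path_len n h"
  define E where "E = eval_trm (rel_alg C) (letter_rel n (Suc h))"
  define p where "p = blocks n (fst (word K n h))"
  define q where "q = blocks n (snd (word K n h))"
  have path_len: "length p = n" "length q = n" by (simp_all add: p_def q_def blocks_def)
  have N: "path_len n (Suc h) = 2 * n * L" by (simp add: L_def)
  have copy: "(copy_pt n L c a, copy_pt n L c b) \<in> E (rename (\<lambda>x. prod_encode (l, x)) t)"
    if "(a, b) \<in> eval_trm (rel_alg C) (letter_rel n h) t" "l < n" "c \<in> {l, n + l}" for a b c l t
    using eval_double[OF that(1,3), of L C] that(2) by (simp add: E_def eval_rename L_def)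
  have P: "(copy_pt n L c 0, copy_pt n L c L) \<in> E (p ! l)" and Q: "(copy_pt n L c L, copy_pt n L c 0) \<in> E (q ! l)"
    if "l < n" "c \<in> {l, n + l}" for c l
    using copy[OF _ that] Suc.IH that(1) by (simp_all add: p_def q_def blocks_def L_def)
  have first: "(l * L, l * L + L) \<in> E (p ! l)" "(l * L + L, l * L) \<in> E (q ! l)"
    and second: "(n * L + l * L + L, n * L + l * L) \<in> E (p ! l)" "(n * L + l * L, n * L + l * L + L) \<in> E (q ! l)"
    if "l < n" for l
    using P[OF that, of l] P[OF that, of "n + l"] Q[OF that, of l] Q[OF that, of "n + l"] that
    by (simp_all add: copy_pt_less copy_pt_ge)
  \<comment> \<open>The later half of the factors consists of inverse words. Copy
    \<open>n + l\<close> runs backwards, so that they too advance to the right.\<close>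
  have "(k * L, Suc k * L) \<in> E ((p @ q) ! k)" if "k < length (p @ q)" for k
  proof (cases "k < n")
    case True
    then show ?thesis using first(1)[OF True] path_len by (simp add: nth_append add.commute)
  next
    case False
    define l where "l = k - n"
    have "k = n + l" "l < n" using False that path_len by (auto simp: l_def)
    then show ?thesis using second(2)[of l] path_len by (simp add: nth_append algebra_simps)
  qed
  from eval_tprod_path[of "p @ q" "\<lambda>k. k * L", folded E_def, OF _ this[unfolded E_def]]
  have U: "(0, 2 * n * L) \<in> E (tprod (p @ q))" using n path_len by (auto simp: E_def mult_2)
  \<comment> \<open>The formal inverse runs along the same path from right to left, through the
    second copies and then the first ones.\<close>
  have "((2 * n - k) * L, (2 * n - Suc k) * L) \<in> E ((rev p @ rev q) ! k)" if "k < length (rev p @ rev q)" for k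
  proof (cases "k < n")
    case True
    define l where "l = n - Suc k"
    have "2 * n - k = n + l + 1" "2 * n - Suc k = n + l" "l < n" using True by (auto simp: l_def)
    moreover have "(rev p @ rev q) ! k = p ! l" using True path_len by (simp add: nth_append rev_nth l_def)
    ultimately show ?thesis using second(1)[of l] by (simp add: algebra_simps)
  next
    case False
    define l where "l = n - Suc (k - n)"
    have "2 * n - k = l + 1" "2 * n - Suc k = l" "l < n" using False that path_len by (auto simp: l_def)
    moreover have "(rev p @ rev q) ! k = q ! l" using False that path_len by (simp add: nth_append rev_nth l_def)
    ultimately show ?thesis using first(2)[of l] by (simp add: algebra_simps)
  qed
  from eval_tprod_path[of "rev p @ rev q" "\<lambda>k. (2 * n - k) * L", OF _ this[unfolded E_def]]
  have U': "(2 * n * L, 0) \<in> E (tprod (rev p @ rev q))" using n path_len by (auto simp: E_def mult_2)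
  show ?case
    unfolding N using eval_bar_path[OF U[unfolded E_def] U'[unfolded E_def], of K]
    by (simp add: Let_def p_def q_def)
qed

lemma is_alg22_path_rels: "n \<ge> 2 \<Longrightarrow> is_alg22 (rel_alg (path_rels n h))"
  using letter_rel_path_rels path_rels_Int path_rels_relcomp by (fastforce simp: is_alg22_def)

text \<open>If the value were equal to its square, single-valuedness would make the last point a
  fixed point, which injectivity excludes because 0 is mapped there already.\<close>

lemma word_not_idem_path_rels:
  assumes n: "n \<ge> 2"
  shows "\<not> holds_in (fst (word K n h), Mul (fst (word K n h)) (fst (word K n h))) (rel_alg (path_rels n h))"
proof
  let ?R = "rel_alg (path_rels n h)"
  let ?w = "eval_trm ?R (letter_rel n h) (fst (word K n h))"
  have letter_rel: "range (letter_rel n h) \<subseteq> carrier ?R" using letter_rel_path_rels by auto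
  assume "holds_in (fst (word K n h), Mul (fst (word K n h)) (fst (word K n h))) ?R"
  then have w: "?w = ?w O ?w" using letter_rel unfolding holds_in_def by simp
  have rprod: "?w \<in> path_rels n h" using eval_closed[OF is_alg22_path_rels[OF n] letter_rel] by simp
  have 0: "(0, path_len n h) \<in> ?w" using word_path n by simp
  then obtain q where q: "(0, q) \<in> ?w" "(q, path_len n h) \<in> ?w" using w by blast
  have "q = path_len n h" using path_rels_single_valued[OF rprod n q(1) 0] .
  then have "0 = path_len n h" using path_rels_single_valued_conv[OF rprod n 0] q(2) by simp
  then show False using path_len_pos[of n h] n by simp
qed

section \<open>Copying the finite algebra into a given infinite type, and the conclusion\<close>

definition transport :: "('a \<Rightarrow> 'b) \<Rightarrow> 'a alg22 \<Rightarrow> 'b alg22" where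
  "transport g A = \<lparr>carrier = g ` carrier A,
     add_op = (\<lambda>x y. g (add_op A (inv_into (carrier A) g x) (inv_into (carrier A) g y))),
     mul_op = (\<lambda>x y. g (mul_op A (inv_into (carrier A) g x) (inv_into (carrier A) g y)))\<rparr>"

lemma eval_transport:
  assumes A: "is_alg22 A" and g: "inj_on g (carrier A)" and v: "range v \<subseteq> carrier A"
  shows "eval_trm (transport g A) (\<lambda>x. g (v x)) t = g (eval_trm A v t)"
  using eval_closed[OF A v] by (induction t) (simp_all add: transport_def inv_into_f_f[OF g])

lemma is_alg22_transport:
  assumes A: "is_alg22 A" and g: "inj_on g (carrier A)"
  shows "is_alg22 (transport g A)"
  using A inv_into_f_f[OF g] by (auto simp: is_alg22_def transport_def)

lemma holds_in_transport:
  assumes A: "is_alg22 A" and g: "inj_on g (carrier A)"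
  shows "holds_in \<epsilon> (transport g A) \<longleftrightarrow> holds_in \<epsilon> A"
proof
  assume h: "holds_in \<epsilon> (transport g A)"
  show "holds_in \<epsilon> A"
    unfolding holds_in_def
  proof (intro allI impI)
    fix v :: "nat \<Rightarrow> 'a" assume v: "range v \<subseteq> carrier A"
    then have "range (\<lambda>x. g (v x)) \<subseteq> carrier (transport g A)" by (auto simp: transport_def)
    then have "g (eval_trm A v (fst \<epsilon>)) = g (eval_trm A v (snd \<epsilon>))"
      using h unfolding holds_in_def by (metis eval_transport[OF A g v])
    then show "eval_trm A v (fst \<epsilon>) = eval_trm A v (snd \<epsilon>)"
      using eval_closed[OF A v] g by (meson inj_onD)
  qed
next
  assume h: "holds_in \<epsilon> A"
  show "holds_in \<epsilon> (transport g A)"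
    unfolding holds_in_def
  proof (intro allI impI)
    fix w :: "nat \<Rightarrow> 'b" assume w: "range w \<subseteq> carrier (transport g A)"
    define v where "v x = inv_into (carrier A) g (w x)" for x
    have wi: "w x \<in> g ` carrier A" for x using w by (auto simp: transport_def)
    have v: "range v \<subseteq> carrier A" using inv_into_into[OF wi] by (auto simp: v_def)
    have "w = (\<lambda>x. g (v x))" using f_inv_into_f[OF wi] by (simp add: v_def)
    then show "eval_trm (transport g A) w (fst \<epsilon>) = eval_trm (transport g A) w (snd \<epsilon>)"
      using eval_transport[OF A g v] h v unfolding holds_in_def by simp
  qed
qed

lemma finite_path_rels: "finite (path_rels n h)"
proof (rule finite_subset)
  show "path_rels n h \<subseteq> Pow ({..path_len n h} \<times> {..path_len n h})" using path_rels_bounded by blast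
qed simp

theorem theorem4p2:
  fixes S :: "'a alg22"
  assumes "infinite (UNIV :: 'b set)"
    and "ai_semiring S"
    and "finite (carrier S)"
    and "block_group (carrier S) (mul_op S)"
    and "subgroups_solvable (carrier S) (mul_op S)"
    and "identities_of S \<subseteq> identities_of B21"
  shows "\<not> has_finite_basis TYPE('b) S"
proof
  assume "has_finite_basis TYPE('b) S"
  then obtain E where E: "finite E" "E \<subseteq> identities_of S"
    and basis: "\<And>B :: 'b alg22. is_alg22 B \<Longrightarrow> E \<subseteq> identities_of B \<Longrightarrow> identities_of S \<subseteq> identities_of B"
    unfolding has_finite_basis_def identity_basis_def by blast
  have "is_alg22 S" using assms(2) by (simp add: ai_semiring_def)
  \<comment> \<open>\<open>K\<close> and \<open>h\<close> depend only on \<open>S\<close>, so that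
    \<open>n\<close> can still be adapted to the presumed basis.\<close>
  then obtain K h where Kh: "\<And>n. n > 0 \<Longrightarrow> (fst (word K n h), Mul (fst (word K n h)) (fst (word K n h))) \<in> identities_of S"
    using block_group_word[OF _ assms(3-5)] unfolding identities_of_def by auto
  define X where "X = (\<Union>\<epsilon>\<in>E. vars (fst \<epsilon>) \<union> vars (snd \<epsilon>))"
  have X: "finite X" using E(1) finite_vars by (simp add: X_def)
  \<comment> \<open>This exceeds the number of variables in the basis, and at least three blocks are
    available for the flips in \<open>admissible_three\<close>.\<close>
  define n where "n = card X + 3"
  let ?R = "rel_alg (path_rels n h)"
  have R: "is_alg22 ?R" by (rule is_alg22_path_rels) (simp add: n_def)
  obtain T :: "'b set" where T: "finite T" "card T = card (path_rels n h)"
    using infinite_arbitrarily_large[OF assms(1)] by blast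
  then obtain g where "bij_betw g (path_rels n h) T"
    using finite_same_card_bij[OF finite_path_rels] by metis
  then have g: "inj_on g (carrier ?R)" by (simp add: bij_betw_def)
  have "\<epsilon> \<in> identities_of (transport g ?R)" if e: "\<epsilon> \<in> E" for \<epsilon>
  proof -
    obtain s t where state: "\<epsilon> = (s, t)" by fastforce
    have "(s, t) \<in> identities_of B21" using e E(2) assms(6) state by blast
    moreover have "card (vars s \<union> vars t) \<le> card X"
      using e state X by (intro card_mono) (force simp: X_def)+
    ultimately have "holds_in \<epsilon> ?R"
      unfolding state by (intro B21_identity_path_rels) (simp_all add: n_def)
    then show ?thesis using holds_in_transport[OF R g] by (simp add: identities_of_def)
  qed
  then have "identities_of S \<subseteq> identities_of (transport g ?R)"
    using basis[OF is_alg22_transport[OF R g]] by blast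
  then have "holds_in (fst (word K n h), Mul (fst (word K n h)) (fst (word K n h))) ?R"
    using Kh[of n] holds_in_transport[OF R g] by (auto simp: identities_of_def n_def)
  then show False using word_not_idem_path_rels[of n K h] by (simp add: n_def)
qed

end
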